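(* Let $\mathcal{P}$ be the algebra of on-shell polynomials in the massless fields $v_\mu,u,\tilde u$ and their derivatives, with the differential $d_Q$, and let $Z_Q$ be its space of cocycles. Let $p \in Z_{Q}$. Then $p$ is cohomologous to a polynomial in $u$ and $F^{(0)}_{\mu\nu;\rho_{1},\dots,\rho_{n}}$ ($n\ge0$). If one factorizes the space $\mathcal{P}_{0} \subset \mathcal{P}$ of such polynomials by the Bianchi identities, one obtains a space isomorphic to the cohomology space $H_{Q}$ of $d_{Q}$.
   Context: Four-dimensional Minkowski space, $\eta=\mathrm{diag}(1,-1,-1,-1)$. $\mathcal{P}$ is the graded-commutative algebra of polynomials in the classical fields $v_\mu$ (even), $u,\tilde u$ (odd) and their derivatives, on the mass shell with zero mass: $d_\mu d^\mu v_\nu=d_\mu d^\mu u=d_\mu d^\mu\tilde u=0$ together with all derivatives of these equations; $d_\mu$ are the formal (total) derivatives, and an index after a semicolon (or an extra index on a scalar) denotes such a derivative. $d_Q$ is the graded derivation of $\mathcal{P}$ with $$d_{Q}v_{\mu} = i\, d_{\mu}u, \qquad d_{Q}u = 0, \qquad d_{Q}\tilde{u} = - i\,B,\qquad [d_{Q}, d_{\mu} ] = 0,\qquad B \equiv d_{\mu}v^{\mu};$$ $d_Q^2=0$. $Z_Q=\ker d_Q$, $B_Q=d_Q\mathcal{P}$, $H_Q=Z_Q/B_Q$; two cocycles are cohomologous if they differ by an element of $B_Q$. The field strength is $F_{\mu\nu} = d_{\mu}v_{\nu} - d_{\nu}v_{\mu}$, $F_{\mu\nu;\rho_1,\dots,\rho_n}=d_{\rho_1}\cdots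 d_{\rho_n}F_{\mu\nu}$, $B_{\mu_1,\dots,\mu_k}=d_{\mu_1}\cdots d_{\mu_k}B$, and $$F^{(0)}_{\mu\nu;\rho_{1},\dots,\rho_{n}} \equiv F_{\mu\nu;\rho_{1},\dots,\rho_{n}} + \frac{1}{n + 2}\sum_{l=1}^{n} \left[\eta_{\mu\rho_{l}}\, B_{\nu,\rho_{1},\dots,\hat{\rho}_{l},\dots,\rho_{n}} - (\mu \leftrightarrow \nu) \right],$$ which is traceless in all indices. The Bianchi identities are $F_{\mu\nu;\rho} + F_{\nu\rho;\mu} + F_{\rho\mu;\nu} = 0$ and their derivatives; they are also satisfied by the $F^{(0)}$. *)

theory Defs
  imports Complex_Main "HOL-Library.Multiset" "HOL-Library.Poly_Mapping" "HOL-Library.Numeral_Type"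
begin

section \<open>Graded-commutative complex algebras given by generators and relations\<close>

datatype 'g word = Word (letters: "'g list")

instantiation word :: (type) monoid_add
begin
definition zero_word :: "'a word" where "zero_word = Word []"
definition plus_word :: "'a word \<Rightarrow> 'a word \<Rightarrow> 'a word" where
  "plus_word v w = Word (letters v @ letters w)"
instance by standard (auto simp: zero_word_def plus_word_def)
end

text \<open>The convolution algebra of finitely supported functions on words is the free associative
  unital algebra.\<close>

type_synonym 'g free = "'g word \<Rightarrow>\<^sub>0 complex"

definition cst :: "complex \<Rightarrow> 'g free" where "cst c = Poly_Mapping.single 0 c"

definition monomial :: "'g list \<Rightarrow> 'g free" where "monomial w = Poly_Mapping.single (Word w) 1"

definition gen :: "'g \<Rightarrow> 'g free" where "gen g = monomial [g]"

inductive_set ideal_gen :: "'a::{ring, monoid_mult} set \<Rightarrow> 'a set" for R where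
  zero: "0 \<in> ideal_gen R"
| mult: "r \<in> R \<Longrightarrow> a * r * b \<in> ideal_gen R"
| add: "x \<in> ideal_gen R \<Longrightarrow> y \<in> ideal_gen R \<Longrightarrow> x + y \<in> ideal_gen R"

class presented =
  fixes odd_gen :: "'a \<Rightarrow> bool"
    and relators :: "('a word \<Rightarrow>\<^sub>0 complex) set"

text \<open>\<open>g h = (-1)^{|g| |h|} h g\<close> for generators \<open>g, h\<close>.\<close>

definition graded_comm :: "'g::presented free set" where
  "graded_comm =
     {gen g * gen h - cst (if odd_gen g \<and> odd_gen h then -1 else 1) * (gen h * gen g) | g h. True}"

definition rel_ideal :: "'g::presented free set" where
  "rel_ideal = ideal_gen (graded_comm \<union> relators)"

lemma ideal_gen_base: "r \<in> R \<Longrightarrow> r \<in> ideal_gen R"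
  using ideal_gen.mult[of r R 1 1] by simp

lemma ideal_gen_lmult: "x \<in> ideal_gen R \<Longrightarrow> c * x \<in> ideal_gen R"
  by (induction rule: ideal_gen.induct)
     (auto simp: distrib_left mult.assoc[symmetric] intro: ideal_gen.intros)

lemma ideal_gen_rmult: "x \<in> ideal_gen R \<Longrightarrow> x * c \<in> ideal_gen R"
proof (induction rule: ideal_gen.induct)
  case (mult r a b)
  then show ?case using ideal_gen.mult[of r R a "b * c"] by (simp add: mult.assoc)
qed (auto simp: distrib_right intro: ideal_gen.intros)

lemma ideal_gen_uminus: "x \<in> ideal_gen R \<Longrightarrow> - x \<in> ideal_gen R"
  using ideal_gen_lmult[of x R "- 1"] by (simp add: minus_mult_left[symmetric])

lemma ideal_gen_diff: "x \<in> ideal_gen R \<Longrightarrow> y \<in> ideal_gen R \<Longrightarrow> x - y \<in> ideal_gen R"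
  using ideal_gen.add[of x R "-y"] ideal_gen_uminus[of y R] by simp

lemma ideal_gen_sum: "(\<And>i. i \<in> A \<Longrightarrow> f i \<in> ideal_gen R) \<Longrightarrow> sum f A \<in> ideal_gen R"
  by (induction A rule: infinite_finite_induct) (auto intro: ideal_gen.intros)

lemma ideal_gen_equivp: "equivp (\<lambda>p q. p - q \<in> ideal_gen R)"
proof (rule equivpI)
  show "reflp (\<lambda>p q. p - q \<in> ideal_gen R)"
    by (rule reflpI) (simp add: ideal_gen.zero)
  show "symp (\<lambda>p q. p - q \<in> ideal_gen R)"
    by (rule sympI) (metis ideal_gen_uminus minus_diff_eq)
  show "transp (\<lambda>p q. p - q \<in> ideal_gen R)"
  proof (rule transpI)
    fix x y z :: 'a assume "x - y \<in> ideal_gen R" "y - z \<in> ideal_gen R"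
    then have "(x - y) + (y - z) \<in> ideal_gen R" by (rule ideal_gen.add)
    then show "x - z \<in> ideal_gen R" by simp
  qed
qed

quotient_type (overloaded) 'g salg = "'g::presented free" / "\<lambda>p q. p - q \<in> rel_ideal"
  unfolding rel_ideal_def by (rule ideal_gen_equivp)

text \<open>Not declared as an instance of \<open>ring_1\<close>, which would require \<open>0 \<noteq> 1\<close>; that fails for
  some presentations.\<close>

instantiation salg :: (presented) "{ring, monoid_mult}"
begin
lift_definition zero_salg :: "'a salg" is 0 .
lift_definition one_salg :: "'a salg" is 1 .
lift_definition plus_salg :: "'a salg \<Rightarrow> 'a salg \<Rightarrow> 'a salg" is "(+)"
proof -
  fix a b c d :: "'a free"
  assume "a - b \<in> rel_ideal" "c - d \<in> rel_ideal"
  then have "(a - b) + (c - d) \<in> rel_ideal" unfolding rel_ideal_def by (rule ideal_gen.add)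
  then show "(a + c) - (b + d) \<in> rel_ideal" by (simp add: algebra_simps)
qed
lift_definition uminus_salg :: "'a salg \<Rightarrow> 'a salg" is uminus
proof -
  fix a b :: "'a free"
  assume "a - b \<in> rel_ideal"
  then have "- (a - b) \<in> rel_ideal" unfolding rel_ideal_def by (rule ideal_gen_uminus)
  then show "(- a) - (- b) \<in> rel_ideal" by simp
qed
lift_definition minus_salg :: "'a salg \<Rightarrow> 'a salg \<Rightarrow> 'a salg" is "(-)"
proof -
  fix a b c d :: "'a free"
  assume "a - b \<in> rel_ideal" "c - d \<in> rel_ideal"
  then have "(a - b) - (c - d) \<in> rel_ideal" unfolding rel_ideal_def by (rule ideal_gen_diff)
  then show "(a - c) - (b - d) \<in> rel_ideal" by (simp add: algebra_simps)
qed
lift_definition times_salg :: "'a salg \<Rightarrow> 'a salg \<Rightarrow> 'a salg" is "(*)"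
proof -
  fix a b c d :: "'a free"
  assume "a - b \<in> rel_ideal" "c - d \<in> rel_ideal"
  then have "(a - b) * c + b * (c - d) \<in> rel_ideal" unfolding rel_ideal_def
    by (intro ideal_gen.add ideal_gen_lmult ideal_gen_rmult)
  then show "a * c - b * d \<in> rel_ideal" by (simp add: algebra_simps)
qed
instance
  by standard (transfer; simp add: algebra_simps rel_ideal_def ideal_gen.zero)+
end

lemma cst_0 [simp]: "cst 0 = 0" and cst_1 [simp]: "cst 1 = 1"
  by (simp_all add: cst_def)

lemma cst_add: "cst (a + b) = cst a + cst b"
  by (simp add: cst_def single_add)

lemma cst_mult: "cst (a * b) = cst a * cst b"
  by (simp add: cst_def mult_single)

lemma cst_uminus: "cst (- a) = - cst a"
  by (simp add: cst_def single_uminus)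

lemma monomial_Nil [simp]: "monomial [] = 1"
  by (simp add: monomial_def zero_word_def[symmetric])

lemma monomial_append: "monomial (v @ w) = monomial v * monomial w"
  by (simp add: monomial_def mult_single plus_word_def)

lemma monomial_Cons: "monomial (g # w) = gen g * monomial w"
  using monomial_append[of "[g]" w] by (simp add: gen_def)

lemma free_induct [case_names zero mon add]:
  assumes "P 0" "\<And>c w. P (cst c * monomial w)" "\<And>p q. P p \<Longrightarrow> P q \<Longrightarrow> P (p + q)"
  shows "P (p :: 'g free)"
proof -
  have single: "P (Poly_Mapping.single w c)" for w c
    using assms(2)[of c "letters w"] by (simp add: cst_def monomial_def mult_single)
  have "P (\<Sum>w\<in>A. Poly_Mapping.single w (Poly_Mapping.lookup p w))" if "finite A" for A
    using that by (induction A rule: finite_induct) (auto simp: assms single)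
  from this[of "Poly_Mapping.keys p"]
  have "P (\<Sum>w\<in>Poly_Mapping.keys p. Poly_Mapping.single w (Poly_Mapping.lookup p w))" by simp
  also have "(\<Sum>w\<in>Poly_Mapping.keys p. Poly_Mapping.single w (Poly_Mapping.lookup p w)) = p"
    by (rule poly_mapping_eqI)
       (auto simp: lookup_sum lookup_single when_def in_keys_iff)
  finally show ?thesis .
qed

lemma cst_commute: "cst c * p = p * (cst c :: 'g free)"
proof (induction p rule: free_induct)
  case (mon d w)
  show ?case by (simp add: cst_def monomial_def mult_single mult.commute zero_word_def plus_word_def)
qed (auto simp: algebra_simps)

lift_definition scaleS :: "complex \<Rightarrow> 'g::presented salg \<Rightarrow> 'g salg" is "\<lambda>c p. cst c * p"
  by (metis ideal_gen_lmult rel_ideal_def right_diff_distrib)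

lift_definition genS :: "'g::presented \<Rightarrow> 'g salg" is gen .

lemma vector_space_scaleS: "vector_space (scaleS :: complex \<Rightarrow> 'g::presented salg \<Rightarrow> 'g salg)"
  by unfold_locales
     (transfer; simp add: algebra_simps cst_add cst_mult rel_ideal_def ideal_gen.zero)+

interpretation scaleS: vector_space "scaleS :: complex \<Rightarrow> 'g::presented salg \<Rightarrow> 'g salg"
  by (rule vector_space_scaleS)

lemma scaleS_mult_left: "scaleS c x * y = scaleS c (x * y)"
  by transfer (simp add: mult.assoc rel_ideal_def ideal_gen.zero)

lemma scaleS_mult_right: "x * scaleS c y = scaleS c (x * y)"
proof transfer
  fix x y :: "'a free" and c
  have "x * (cst c * y) = cst c * (x * y)"
    by (simp add: mult.assoc[symmetric] cst_commute[of c x])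
  then show "x * (cst c * y) - cst c * (x * y) \<in> rel_ideal"
    by (simp add: rel_ideal_def ideal_gen.zero)
qed

lemma genS_graded_comm:
  "genS g * genS h = scaleS (if odd_gen g \<and> odd_gen h then -1 else 1) (genS h * genS g)"
  by transfer (auto simp: rel_ideal_def graded_comm_def intro!: ideal_gen_base)


section \<open>Linear extension, graded derivations and substitutions\<close>

text \<open>Extension of a function on words to a linear map on the free algebra, for a target with scalar
  multiplication \<open>s\<close>.\<close>

definition extend :: "(complex \<Rightarrow> 'b \<Rightarrow> 'b) \<Rightarrow> ('g list \<Rightarrow> 'b::ab_group_add) \<Rightarrow> 'g free \<Rightarrow> 'b" where
  "extend s f p = (\<Sum>w\<in>Poly_Mapping.keys p. s (Poly_Mapping.lookup p w) (f (letters w)))"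

definition scaleF :: "complex \<Rightarrow> 'g free \<Rightarrow> 'g free" where "scaleF c p = cst c * p"

interpretation scaleF: vector_space "scaleF :: complex \<Rightarrow> 'g free \<Rightarrow> 'g free"
  by unfold_locales (simp_all add: scaleF_def algebra_simps cst_add cst_mult)

definition parity_sign :: "bool \<Rightarrow> 'g::presented list \<Rightarrow> complex" where
  "parity_sign \<epsilon> w = (if \<epsilon> then (-1) ^ length (filter odd_gen w) else 1)"

text \<open>The left derivation of parity \<open>\<epsilon>\<close> with prescribed values \<open>\<delta>\<close> on the generators.\<close>

fun der_word :: "bool \<Rightarrow> ('g::presented \<Rightarrow> 'g free) \<Rightarrow> 'g list \<Rightarrow> 'g free" where
  "der_word \<epsilon> \<delta> [] = 0"
| "der_word \<epsilon> \<delta> (g # w) = \<delta> g * monomial w + cst (parity_sign \<epsilon> [g]) * (gen g * der_word \<epsilon> \<delta> w)"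

definition free_der :: "bool \<Rightarrow> ('g::presented \<Rightarrow> 'g free) \<Rightarrow> 'g free \<Rightarrow> 'g free" where
  "free_der \<epsilon> \<delta> = extend scaleF (der_word \<epsilon> \<delta>)"

definition free_twist :: "bool \<Rightarrow> 'g::presented free \<Rightarrow> 'g free" where
  "free_twist \<epsilon> = extend scaleF (\<lambda>w. cst (parity_sign \<epsilon> w) * monomial w)"

context
  fixes s :: "complex \<Rightarrow> 'b::ab_group_add \<Rightarrow> 'b"
  assumes s: "vector_space s"
begin

interpretation vector_space s by (rule s)

lemma extend_zero: "extend s f 0 = 0"
  by (simp add: extend_def)

lemma extend_add: "extend s f (p + q) = extend s f p + extend s f q"
  unfolding extend_def
  by (rule setsum_keys_plus_distrib) (simp_all add: scale_left_distrib)

lemma extend_term: "extend s f (cst c * monomial w) = s c (f w)"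
  by (cases "c = 0") (simp_all add: extend_def cst_def monomial_def mult_single)

lemma extend_monomial: "extend s f (monomial w) = f w"
  using extend_term[of f 1 w] by simp

lemma extend_scale: "extend s f (cst c * p) = s c (extend s f p)"
proof (induction p rule: free_induct)
  case (mon d w)
  have "cst c * (cst d * monomial w) = cst (c * d) * monomial w"
    by (simp add: cst_mult mult.assoc)
  then show ?case by (simp only: extend_term) simp
qed (simp_all add: extend_zero extend_add distrib_left scale_right_distrib)

lemma extend_uminus: "extend s f (- p) = - extend s f p"
  using extend_scale[of f "-1" p] by (simp add: cst_uminus)

lemma extend_diff: "extend s f (p - q) = extend s f p - extend s f q"
  using extend_add[of f p "- q"] by (simp add: extend_uminus)

lemma extend_sum: "extend s f (sum p A) = (\<Sum>a\<in>A. extend s f (p a))"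
  by (induction A rule: infinite_finite_induct) (simp_all add: extend_zero extend_add)

end

lemmas free_der_simps =
  extend_zero[OF scaleF.vector_space_axioms, where f = "der_word \<epsilon> \<delta>" for \<epsilon> \<delta>, folded free_der_def]
  extend_add[OF scaleF.vector_space_axioms, where f = "der_word \<epsilon> \<delta>" for \<epsilon> \<delta>, folded free_der_def]
  extend_uminus[OF scaleF.vector_space_axioms, where f = "der_word \<epsilon> \<delta>" for \<epsilon> \<delta>, folded free_der_def]
  extend_diff[OF scaleF.vector_space_axioms, where f = "der_word \<epsilon> \<delta>" for \<epsilon> \<delta>, folded free_der_def]
  extend_sum[OF scaleF.vector_space_axioms, where f = "der_word \<epsilon> \<delta>" for \<epsilon> \<delta>, folded free_der_def]
  extend_scale[OF scaleF.vector_space_axioms, where f = "der_word \<epsilon> \<delta>" for \<epsilon> \<delta>,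
    folded free_der_def, unfolded scaleF_def]

lemmas free_der_monomial =
  extend_monomial[OF scaleF.vector_space_axioms, where f = "der_word \<epsilon> \<delta>" for \<epsilon> \<delta>, folded free_der_def]

lemmas free_twist_simps =
  extend_zero[OF scaleF.vector_space_axioms, where f = "\<lambda>w. cst (parity_sign \<epsilon> w) * monomial w" for \<epsilon>,
    folded free_twist_def]
  extend_add[OF scaleF.vector_space_axioms, where f = "\<lambda>w. cst (parity_sign \<epsilon> w) * monomial w" for \<epsilon>,
    folded free_twist_def]
  extend_uminus[OF scaleF.vector_space_axioms, where f = "\<lambda>w. cst (parity_sign \<epsilon> w) * monomial w" for \<epsilon>,
    folded free_twist_def]
  extend_diff[OF scaleF.vector_space_axioms, where f = "\<lambda>w. cst (parity_sign \<epsilon> w) * monomial w" for \<epsilon>,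
    folded free_twist_def]
  extend_sum[OF scaleF.vector_space_axioms, where f = "\<lambda>w. cst (parity_sign \<epsilon> w) * monomial w" for \<epsilon>,
    folded free_twist_def]
  extend_scale[OF scaleF.vector_space_axioms, where f = "\<lambda>w. cst (parity_sign \<epsilon> w) * monomial w" for \<epsilon>,
    folded free_twist_def, unfolded scaleF_def]

lemmas free_twist_monomial =
  extend_monomial[OF scaleF.vector_space_axioms, where f = "\<lambda>w. cst (parity_sign \<epsilon> w) * monomial w" for \<epsilon>,
    folded free_twist_def]

lemma parity_sign_append: "parity_sign \<epsilon> (v @ w) = parity_sign \<epsilon> v * parity_sign \<epsilon> w"
  by (simp add: parity_sign_def power_add)

lemma cst_left_commute: "p * (cst c * q) = cst c * (p * (q :: 'g free))"
  by (simp add: mult.assoc[symmetric] cst_commute[of c p])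

lemma cst_cst: "cst c * (cst d * p) = cst (c * d) * p"
  by (simp add: cst_mult mult.assoc)

lemmas cst_out =
  cst_left_commute[where p = "monomial v" for v] cst_left_commute[where p = "gen g" for g]
  cst_left_commute[where p = "der_word \<epsilon> \<delta> v" for \<epsilon> \<delta> v] cst_cst

lemma free_twist_mult: "free_twist \<epsilon> (p * q) = free_twist \<epsilon> p * free_twist \<epsilon> q"
proof (induction p rule: free_induct)
  case (mon c v)
  show ?case
  proof (induction q rule: free_induct)
    case (mon d w)
    have "cst c * monomial v * (cst d * monomial w) = cst (c * d) * monomial (v @ w)"
      by (simp add: monomial_append mult.assoc cst_out)
    then have "free_twist \<epsilon> (cst c * monomial v * (cst d * monomial w)) =
        cst (c * d * parity_sign \<epsilon> (v @ w)) * monomial (v @ w)"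
      by (simp only: free_twist_simps free_twist_monomial cst_cst)
    then show ?case
      by (simp add: free_twist_simps free_twist_monomial parity_sign_append monomial_append
          mult.assoc cst_out mult.left_commute[of d])
  qed (simp_all add: free_twist_simps distrib_left)
qed (simp_all add: free_twist_simps distrib_right)

lemma der_word_append:
  "der_word \<epsilon> \<delta> (v @ w) =
     der_word \<epsilon> \<delta> v * monomial w + cst (parity_sign \<epsilon> v) * (monomial v * der_word \<epsilon> \<delta> w)"
proof (induction v)
  case Nil
  show ?case by (simp add: parity_sign_def)
next
  case (Cons g v)
  have "parity_sign \<epsilon> (g # v) = parity_sign \<epsilon> [g] * parity_sign \<epsilon> v"
    using parity_sign_append[of \<epsilon> "[g]" v] by simp
  then show ?case
    by (simp add: Cons.IH monomial_append monomial_Cons distrib_left distrib_right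
        mult.assoc cst_out add.assoc)
qed

lemma free_der_mult:
  "free_der \<epsilon> \<delta> (p * q) = free_der \<epsilon> \<delta> p * q + free_twist \<epsilon> p * free_der \<epsilon> \<delta> q"
proof (induction p rule: free_induct)
  case (mon c v)
  show ?case
  proof (induction q rule: free_induct)
    case (mon d w)
    have "cst c * monomial v * (cst d * monomial w) = cst (c * d) * monomial (v @ w)"
      by (simp add: monomial_append mult.assoc cst_out)
    then have "free_der \<epsilon> \<delta> (cst c * monomial v * (cst d * monomial w)) =
        cst (c * d) * der_word \<epsilon> \<delta> (v @ w)"
      by (simp only: free_der_simps free_der_monomial)
    then show ?case
      by (simp add: free_der_simps free_der_monomial free_twist_simps free_twist_monomial
          der_word_append distrib_left mult.assoc cst_out mult.commute[of d])
  qed (simp_all add: free_der_simps distrib_left add_ac)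
qed (simp_all add: free_der_simps free_twist_simps distrib_right add_ac)

lemma free_der_gen: "free_der \<epsilon> \<delta> (gen g) = \<delta> g"
  by (simp add: gen_def free_der_monomial)

lemma free_twist_gen: "free_twist \<epsilon> (gen g) = cst (parity_sign \<epsilon> [g]) * gen g"
  by (simp add: gen_def free_twist_monomial)

lemma free_twist_cst: "free_twist \<epsilon> (cst c) = (cst c :: 'g::presented free)"
proof -
  have "free_twist \<epsilon> (monomial []) = (1 :: 'g free)"
    unfolding free_twist_monomial by (simp add: parity_sign_def)
  then show ?thesis
    using free_twist_simps(6)[of \<epsilon> c "monomial [] :: 'g free"] by simp
qed

lemma free_der_cst: "free_der \<epsilon> \<delta> (cst c) = 0"
proof -
  have "free_der \<epsilon> \<delta> (monomial []) = 0"
    unfolding free_der_monomial by simp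
  then show ?thesis
    using free_der_simps(6)[of \<epsilon> \<delta> c "monomial []"] by simp
qed

lemma free_twist_ideal:
  assumes "\<And>r. r \<in> relators \<Longrightarrow> free_twist \<epsilon> r \<in> (rel_ideal :: 'g::presented free set)"
    and "p \<in> (rel_ideal :: 'g free set)"
  shows "free_twist \<epsilon> p \<in> rel_ideal"
  using assms(2) unfolding rel_ideal_def
proof (induction rule: ideal_gen.induct)
  case (mult r a b)
  have "free_twist \<epsilon> r \<in> rel_ideal"
  proof (cases "r \<in> relators")
    case False
    with mult obtain g h c where r: "r = gen g * gen h - cst c * (gen h * gen g)"
      by (auto simp: graded_comm_def)
    have "free_twist \<epsilon> r = cst (parity_sign \<epsilon> [g, h]) * r"
      using parity_sign_append[of \<epsilon> "[g]" "[h]"]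
      by (simp add: r free_twist_simps free_twist_mult free_twist_gen mult.assoc
          cst_out right_diff_distrib free_twist_cst mult_ac)
    moreover have "r \<in> rel_ideal"
      using mult by (auto simp: rel_ideal_def intro: ideal_gen_base)
    ultimately show ?thesis by (simp add: rel_ideal_def ideal_gen_lmult)
  qed (simp add: assms(1))
  then show ?case
    by (simp add: free_twist_mult rel_ideal_def ideal_gen_lmult ideal_gen_rmult)
qed (auto simp: free_twist_simps intro: ideal_gen.intros)

lemma free_der_ideal:
  assumes tw: "\<And>r. r \<in> relators \<Longrightarrow> free_twist \<epsilon> r \<in> (rel_ideal :: 'g::presented free set)"
    and comm: "\<And>g h :: 'g. free_der \<epsilon> \<delta>
        (gen g * gen h - cst (if odd_gen g \<and> odd_gen h then -1 else 1) * (gen h * gen g)) \<in> rel_ideal"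
    and rel: "\<And>r. r \<in> relators \<Longrightarrow> free_der \<epsilon> \<delta> r \<in> (rel_ideal :: 'g free set)"
    and p: "p \<in> (rel_ideal :: 'g free set)"
  shows "free_der \<epsilon> \<delta> p \<in> rel_ideal"
  using p unfolding rel_ideal_def
proof (induction rule: ideal_gen.induct)
  case (mult r a b)
  have r: "r \<in> rel_ideal"
    using mult by (auto simp: rel_ideal_def intro: ideal_gen_base)
  have "free_der \<epsilon> \<delta> r \<in> rel_ideal"
    using mult rel comm by (auto simp: graded_comm_def)
  moreover have "free_twist \<epsilon> r \<in> rel_ideal"
    using r tw by (rule free_twist_ideal[rotated])
  ultimately show ?case using r
    by (simp add: free_twist_mult free_der_mult rel_ideal_def ideal_gen_lmult ideal_gen_rmult
        ideal_gen.add distrib_right)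
qed (auto simp: free_der_simps intro: ideal_gen.intros)

text \<open>The algebra homomorphism with prescribed values on the generators.\<close>

definition free_subst :: "('g \<Rightarrow> 'h::presented salg) \<Rightarrow> 'g free \<Rightarrow> 'h salg" where
  "free_subst \<phi> = extend scaleS (\<lambda>w. prod_list (map \<phi> w))"

lemmas free_subst_simps =
  extend_zero[OF vector_space_scaleS, where f = "\<lambda>w. prod_list (map \<phi> w)" for \<phi>, folded free_subst_def]
  extend_add[OF vector_space_scaleS, where f = "\<lambda>w. prod_list (map \<phi> w)" for \<phi>, folded free_subst_def]
  extend_uminus[OF vector_space_scaleS, where f = "\<lambda>w. prod_list (map \<phi> w)" for \<phi>, folded free_subst_def]
  extend_diff[OF vector_space_scaleS, where f = "\<lambda>w. prod_list (map \<phi> w)" for \<phi>, folded free_subst_def]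
  extend_sum[OF vector_space_scaleS, where f = "\<lambda>w. prod_list (map \<phi> w)" for \<phi>, folded free_subst_def]
  extend_scale[OF vector_space_scaleS, where f = "\<lambda>w. prod_list (map \<phi> w)" for \<phi>, folded free_subst_def]

lemmas free_subst_monomial =
  extend_monomial[OF vector_space_scaleS, where f = "\<lambda>w. prod_list (map \<phi> w)" for \<phi>, folded free_subst_def]

lemma free_subst_gen: "free_subst \<phi> (gen g) = \<phi> g"
  by (simp add: gen_def free_subst_monomial)

lemma free_subst_cst: "free_subst \<phi> (cst c) = scaleS c 1"
  using free_subst_simps(6)[of \<phi> c "monomial []"] free_subst_monomial[of \<phi> "[]"]
  by simp

lemma free_subst_mult: "free_subst \<phi> (p * q) = free_subst \<phi> p * free_subst \<phi> q"
proof (induction p rule: free_induct)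
  case (mon c v)
  show ?case
  proof (induction q rule: free_induct)
    case (mon d w)
    have "cst c * monomial v * (cst d * monomial w) = cst (c * d) * monomial (v @ w)"
      by (simp add: monomial_append mult.assoc cst_out)
    then have "free_subst \<phi> (cst c * monomial v * (cst d * monomial w)) =
        scaleS (c * d) (prod_list (map \<phi> (v @ w)))"
      by (simp only: free_subst_simps free_subst_monomial)
    then show ?case
      by (simp add: free_subst_simps free_subst_monomial scaleS_mult_left scaleS_mult_right
          mult.commute)
  qed (simp_all add: free_subst_simps distrib_left)
qed (simp_all add: free_subst_simps distrib_right)

lemma free_subst_ideal:
  assumes comm: "\<And>g h. \<phi> g * \<phi> h = scaleS (if odd_gen g \<and> odd_gen h then -1 else 1) (\<phi> h * \<phi> g)"
    and rel: "\<And>r. r \<in> relators \<Longrightarrow> free_subst \<phi> r = 0"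
    and p: "p \<in> rel_ideal"
  shows "free_subst \<phi> p = 0"
  using p unfolding rel_ideal_def
proof (induction rule: ideal_gen.induct)
  case (mult r a b)
  have "free_subst \<phi> r = 0"
  proof (cases "r \<in> relators")
    case False
    with mult obtain g h c where r: "r = gen g * gen h - cst c * (gen h * gen g)"
      and c: "c = (if odd_gen g \<and> odd_gen h then -1 else 1)"
      by (auto simp: graded_comm_def)
    have "\<phi> g * \<phi> h = scaleS c (\<phi> h * \<phi> g)" using comm[of g h] unfolding c .
    then show ?thesis
      by (simp add: r free_subst_simps free_subst_mult free_subst_gen free_subst_cst scaleS_mult_left)
  qed (rule rel)
  then show ?case by (simp add: free_subst_mult)
qed (auto simp: free_subst_simps)

definition free_graded :: "bool \<Rightarrow> 'g::presented free \<Rightarrow> bool" where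
  "free_graded a x \<longleftrightarrow>
     (\<forall>h. x * gen h - cst (if a \<and> odd_gen h then -1 else 1) * (gen h * x) \<in> rel_ideal)"

lemma free_graded_gen: "odd_gen g = a \<Longrightarrow> free_graded a (gen g)"
  by (auto simp: free_graded_def rel_ideal_def graded_comm_def intro!: ideal_gen_base)

lemma free_graded_zero: "free_graded a 0"
  by (simp add: free_graded_def rel_ideal_def ideal_gen.zero)

lemma free_graded_add:
  assumes "free_graded a x" "free_graded a (y :: 'a::presented free)" shows "free_graded a (x + y)"
  unfolding free_graded_def
proof
  fix h :: 'a
  let ?c = "cst (if a \<and> odd_gen h then -1 else 1)"
  have "(x * gen h - ?c * (gen h * x)) + (y * gen h - ?c * (gen h * y)) \<in> rel_ideal"
    using assms unfolding free_graded_def rel_ideal_def by (blast intro: ideal_gen.add)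
  then show "(x + y) * gen h - ?c * (gen h * (x + y)) \<in> rel_ideal"
    by (simp only: algebra_simps)
qed

lemma free_graded_scale:
  assumes "free_graded a (x :: 'a::presented free)" shows "free_graded a (cst d * x)"
  unfolding free_graded_def
proof
  fix h :: 'a
  let ?s = "if a \<and> odd_gen h then -1 else 1 :: complex"
  have "cst d * (x * gen h - cst ?s * (gen h * x)) \<in> rel_ideal"
    using assms unfolding free_graded_def rel_ideal_def by (blast intro: ideal_gen_lmult)
  moreover have "cst d * (cst ?s * (gen h * x)) = cst ?s * (gen h * (cst d * x))"
    by (simp only: cst_out mult.commute)
  ultimately show "cst d * x * gen h - cst ?s * (gen h * (cst d * x)) \<in> rel_ideal"
    by (simp only: right_diff_distrib mult.assoc)
qed

lemma free_graded_sum: "(\<And>i. i \<in> A \<Longrightarrow> free_graded a (f i)) \<Longrightarrow> free_graded a (sum f A)"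
  by (induction A rule: infinite_finite_induct) (auto intro: free_graded_zero free_graded_add)

lemma free_der_graded_comm:
  assumes "\<And>g. free_graded (odd_gen g \<noteq> \<epsilon>) (\<delta> g)"
  shows "free_der \<epsilon> \<delta> (gen g * gen h
    - cst (if odd_gen g \<and> odd_gen h then -1 else 1) * (gen h * gen g)) \<in> rel_ideal"
proof -
  define c where "c = (if odd_gen g \<and> odd_gen h then -1 else 1 :: complex)"
  define a where "a = (if (odd_gen g \<noteq> \<epsilon>) \<and> odd_gen h then -1 else 1 :: complex)"
  define b where "b = (if (odd_gen h \<noteq> \<epsilon>) \<and> odd_gen g then -1 else 1 :: complex)"
  have signs: "a = c * parity_sign \<epsilon> [h]" "c * b = parity_sign \<epsilon> [g]"
    by (auto simp: a_def b_def c_def parity_sign_def)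
  have "\<delta> g * gen h - cst a * (gen h * \<delta> g) \<in> rel_ideal"
    using assms[of g] unfolding free_graded_def a_def by blast
  moreover have "\<delta> h * gen g - cst b * (gen g * \<delta> h) \<in> rel_ideal"
    using assms[of h] unfolding free_graded_def b_def by blast
  ultimately have "(\<delta> g * gen h - cst a * (gen h * \<delta> g))
      - cst c * (\<delta> h * gen g - cst b * (gen g * \<delta> h)) \<in> rel_ideal"
    unfolding rel_ideal_def by (rule ideal_gen_diff[OF _ ideal_gen_lmult])
  moreover have "free_der \<epsilon> \<delta> (gen g * gen h - cst c * (gen h * gen g)) =
      (\<delta> g * gen h - cst a * (gen h * \<delta> g)) - cst c * (\<delta> h * gen g - cst b * (gen g * \<delta> h))"
    by (simp add: free_der_simps free_der_mult free_der_gen free_twist_gen mult.assoc cst_out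
        distrib_left right_diff_distrib signs free_twist_cst free_der_cst)
  ultimately show ?thesis by (simp add: c_def)
qed


section \<open>On-shell polynomials in the fields\<close>

text \<open>The Minkowski metric; numerically it coincides with its inverse.\<close>

definition eta :: "4 \<Rightarrow> 4 \<Rightarrow> complex" where
  "eta \<mu> \<nu> = (if \<mu> \<noteq> \<nu> then 0 else if \<mu> = 0 then 1 else -1)"

text \<open>\<open>Vj \<mu> R\<close>, \<open>Uj R\<close> and \<open>Tj R\<close> stand for the derivatives of $v_\mu$, $u$ and $\tilde u$; the multiset
  \<open>R\<close> lists the derivative indices, so that formal derivatives commute.\<close>

datatype jet = Vj 4 "4 multiset" | Uj "4 multiset" | Tj "4 multiset"

definition box :: "(4 multiset \<Rightarrow> jet) \<Rightarrow> 4 multiset \<Rightarrow> jet free" where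
  "box j R = (\<Sum>\<mu>\<in>UNIV. \<Sum>\<nu>\<in>UNIV. cst (eta \<mu> \<nu>) * gen (j (add_mset \<mu> (add_mset \<nu> R))))"

text \<open>The relators are the equations of motion together with all their derivatives.\<close>

instantiation jet :: presented
begin
fun odd_gen_jet :: "jet \<Rightarrow> bool" where
  "odd_gen_jet (Vj \<mu> R) = False"
| "odd_gen_jet (Uj R) = True"
| "odd_gen_jet (Tj R) = True"
definition relators_jet :: "jet free set" where
  "relators_jet = {box (Vj \<kappa>) R | \<kappa> R. True} \<union> {box Uj R | R. True} \<union> {box Tj R | R. True}"
instance ..
end

type_synonym onshell = "jet salg"

definition field_v :: "4 \<Rightarrow> onshell" where "field_v \<mu> = genS (Vj \<mu> {#})"
definition field_u :: onshell where "field_u = genS (Uj {#})"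
definition field_ut :: onshell where "field_ut = genS (Tj {#})"

lemma free_twist_box: "free_twist \<epsilon> (box j R) = cst (parity_sign \<epsilon> [j {#}]) * box j R"
  if "\<And>R. odd_gen (j R) = odd_gen (j {#})"
proof -
  have "free_twist \<epsilon> (gen (j R)) = cst (parity_sign \<epsilon> [j {#}]) * gen (j R)" for R
    using that[of R] by (simp add: free_twist_gen parity_sign_def)
  then show ?thesis
    by (simp add: box_def free_twist_simps sum_distrib_left cst_cst mult.commute)
qed

lemma free_twist_relators_jet:
  "r \<in> relators \<Longrightarrow> free_twist \<epsilon> r \<in> (rel_ideal :: jet free set)"
proof -
  assume r: "r \<in> relators"
  then obtain c where "free_twist \<epsilon> r = cst c * r"
    by (auto simp: relators_jet_def free_twist_box intro: exI)
  moreover have "r \<in> rel_ideal"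
    unfolding rel_ideal_def using r by (intro ideal_gen_base) simp
  ultimately show ?thesis
    by (simp add: rel_ideal_def ideal_gen_lmult)
qed

lemma box_rel_ideal: "j \<in> range Vj \<union> {Uj, Tj} \<Longrightarrow> box j R \<in> rel_ideal"
  unfolding rel_ideal_def by (rule ideal_gen_base) (auto simp: relators_jet_def)

fun shift :: "4 \<Rightarrow> jet \<Rightarrow> jet" where
  "shift \<mu> (Vj \<nu> R) = Vj \<nu> (add_mset \<mu> R)"
| "shift \<mu> (Uj R) = Uj (add_mset \<mu> R)"
| "shift \<mu> (Tj R) = Tj (add_mset \<mu> R)"

lemma free_der_shift_box:
  assumes "\<And>R. shift \<mu> (j R) = j (add_mset \<mu> R)"
  shows "free_der False (\<lambda>j. gen (shift \<mu> j)) (box j R) = box j (add_mset \<mu> R)"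
  by (simp add: box_def free_der_simps free_der_gen assms add_mset_commute)

text \<open>The total derivative $d_\mu$.\<close>

lift_definition tderiv :: "4 \<Rightarrow> onshell \<Rightarrow> onshell" is
  "\<lambda>\<mu>. free_der False (\<lambda>j. gen (shift \<mu> j))"
proof -
  fix \<mu> and p q :: "jet free"
  assume "p - q \<in> rel_ideal"
  then have "free_der False (\<lambda>j. gen (shift \<mu> j)) (p - q) \<in> rel_ideal"
  proof (rule free_der_ideal[rotated -1])
    fix r :: "jet free" assume "r \<in> relators"
    then show "free_der False (\<lambda>j. gen (shift \<mu> j)) r \<in> rel_ideal"
      by (auto simp: relators_jet_def free_der_shift_box intro!: box_rel_ideal)
  next
    have "odd_gen (shift \<mu> g) = odd_gen g" for g by (cases g) auto
    then show "free_der False (\<lambda>j. gen (shift \<mu> j)) (gen g * gen h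
        - cst (if odd_gen g \<and> odd_gen h then -1 else 1) * (gen h * gen g)) \<in> rel_ideal" for g h
      by (intro free_der_graded_comm) (simp add: free_graded_gen)
  qed (rule free_twist_relators_jet)
  then show "free_der False (\<lambda>j. gen (shift \<mu> j)) p - free_der False (\<lambda>j. gen (shift \<mu> j)) q
      \<in> rel_ideal"
    by (simp add: free_der_simps)
qed

text \<open>\<open>div_jet R\<close> is $B_{\mu_1,\dots,\mu_k}$ with indices \<open>R\<close>; \<open>brs\<close> gives the values of $d_Q$ on the generators
  that follow from its values on the fields and from $[d_Q, d_\mu] = 0$ (cf. \<open>dQ_v\<close>, \<open>dQ_u\<close>, \<open>dQ_ut\<close>,
  \<open>dQ_tderiv\<close>, \<open>dQ_mult\<close> below).\<close>

definition div_jet :: "4 multiset \<Rightarrow> jet free" where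
  "div_jet R = (\<Sum>\<mu>\<in>UNIV. \<Sum>\<nu>\<in>UNIV. cst (eta \<mu> \<nu>) * gen (Vj \<nu> (add_mset \<mu> R)))"

fun brs :: "jet \<Rightarrow> jet free" where
  "brs (Vj \<mu> R) = cst \<i> * gen (Uj (add_mset \<mu> R))"
| "brs (Uj R) = 0"
| "brs (Tj R) = cst (- \<i>) * div_jet R"

lemma free_der_brs_box:
  "free_der True brs (box (Vj \<kappa>) R) = cst \<i> * box Uj (add_mset \<kappa> R)"
  "free_der True brs (box Uj R) = 0"
  "free_der True brs (box Tj R) =
     cst (- \<i>) * (\<Sum>\<mu>\<in>UNIV. \<Sum>\<nu>\<in>UNIV. cst (eta \<mu> \<nu>) * box (Vj \<nu>) (add_mset \<mu> R))"
proof -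
  show "free_der True brs (box (Vj \<kappa>) R) = cst \<i> * box Uj (add_mset \<kappa> R)"
    by (simp add: box_def free_der_simps free_der_gen sum_distrib_left cst_cst mult.commute
        add_mset_commute)
  show "free_der True brs (box Uj R) = 0"
    by (simp add: box_def free_der_simps free_der_gen)
  have "free_der True brs (box Tj R) = (\<Sum>a\<in>UNIV. \<Sum>b\<in>UNIV. \<Sum>\<mu>\<in>UNIV. \<Sum>\<nu>\<in>UNIV.
      cst (- \<i> * eta \<mu> \<nu> * eta a b) * gen (Vj \<nu> (add_mset \<mu> (add_mset a (add_mset b R)))))"
    by (simp add: box_def free_der_simps free_der_gen sum_distrib_left cst_cst div_jet_def mult_ac
        cst_uminus sum_negf)
  also have "\<dots> = (\<Sum>\<mu>\<in>UNIV. \<Sum>\<nu>\<in>UNIV. \<Sum>a\<in>UNIV. \<Sum>b\<in>UNIV.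
      cst (- \<i> * eta \<mu> \<nu> * eta a b) * gen (Vj \<nu> (add_mset \<mu> (add_mset a (add_mset b R)))))"
    by (subst (2) sum.swap, subst sum.swap, subst (3) sum.swap, subst (2) sum.swap) (rule refl)
  also have "\<dots> = cst (- \<i>) *
      (\<Sum>\<mu>\<in>UNIV. \<Sum>\<nu>\<in>UNIV. cst (eta \<mu> \<nu>) * box (Vj \<nu>) (add_mset \<mu> R))"
    by (simp add: box_def sum_distrib_left cst_cst add_mset_commute mult_ac)
  finally show "free_der True brs (box Tj R) =
     cst (- \<i>) * (\<Sum>\<mu>\<in>UNIV. \<Sum>\<nu>\<in>UNIV. cst (eta \<mu> \<nu>) * box (Vj \<nu>) (add_mset \<mu> R))" .
qed

lift_definition dQ :: "onshell \<Rightarrow> onshell" is "free_der True brs"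
proof -
  fix p q :: "jet free"
  assume "p - q \<in> rel_ideal"
  then have "free_der True brs (p - q) \<in> rel_ideal"
  proof (rule free_der_ideal[rotated -1])
    fix r :: "jet free" assume "r \<in> relators"
    moreover have "cst (- \<i>) * (\<Sum>\<mu>\<in>UNIV. \<Sum>\<nu>\<in>UNIV. cst (eta \<mu> \<nu>) * box (Vj \<nu>) (add_mset \<mu> R))
        \<in> rel_ideal" for R
      using box_rel_ideal unfolding rel_ideal_def
      by (intro ideal_gen_lmult ideal_gen_sum) auto
    moreover have "cst \<i> * box Uj R \<in> rel_ideal" for R
      using box_rel_ideal unfolding rel_ideal_def by (intro ideal_gen_lmult) auto
    moreover have "0 \<in> (rel_ideal :: jet free set)"
      by (simp add: rel_ideal_def ideal_gen.zero)
    ultimately show "free_der True brs r \<in> rel_ideal"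
      by (auto simp only: relators_jet_def free_der_brs_box)
  next
    have "free_graded (odd_gen g \<noteq> True) (brs g)" for g
      by (cases g) (auto simp: div_jet_def
          intro!: free_graded_zero free_graded_scale free_graded_sum free_graded_gen)
    then show "free_der True brs (gen g * gen h
        - cst (if odd_gen g \<and> odd_gen h then -1 else 1) * (gen h * gen g)) \<in> rel_ideal" for g h
      by (rule free_der_graded_comm)
  qed (rule free_twist_relators_jet)
  then show "free_der True brs p - free_der True brs q \<in> rel_ideal"
    by (simp add: free_der_simps)
qed

lemma tderiv_genS: "tderiv \<mu> (genS j) = genS (shift \<mu> j)"
  by transfer (simp add: free_der_gen rel_ideal_def ideal_gen.zero)

lemma tderiv_simps:
  "tderiv \<mu> 0 = 0" "tderiv \<mu> (x + y) = tderiv \<mu> x + tderiv \<mu> y"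
  "tderiv \<mu> (x - y) = tderiv \<mu> x - tderiv \<mu> y"
  "tderiv \<mu> (- x) = - tderiv \<mu> x" "tderiv \<mu> (scaleS c x) = scaleS c (tderiv \<mu> x)"
  by (transfer; simp add: free_der_simps rel_ideal_def ideal_gen.zero)+

lemma tderiv_sum: "tderiv \<mu> (sum f A) = (\<Sum>a\<in>A. tderiv \<mu> (f a))"
  by (induction A rule: infinite_finite_induct) (simp_all add: tderiv_simps)

lemma free_twist_False: "free_twist False p = p"
  by (induction p rule: free_induct)
     (simp_all add: free_twist_simps free_twist_monomial parity_sign_def)

lemma tderiv_mult: "tderiv \<mu> (x * y) = tderiv \<mu> x * y + x * tderiv \<mu> y"
  by transfer (simp add: free_der_mult free_twist_False rel_ideal_def ideal_gen.zero)

text \<open>The parity automorphism: \<open>x\<close> goes to \<open>(-1)\<^sup>n x\<close> for \<open>x\<close> of parity \<open>n\<close>.\<close>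

lift_definition parity_aut :: "onshell \<Rightarrow> onshell" is "free_twist True"
proof -
  fix p q :: "jet free"
  assume "p - q \<in> rel_ideal"
  then have "free_twist True (p - q) \<in> rel_ideal"
    by (rule free_twist_ideal[rotated]) (rule free_twist_relators_jet)
  then show "free_twist True p - free_twist True q \<in> rel_ideal"
    by (simp add: free_twist_simps)
qed

lemma dQ_simps:
  "dQ 0 = 0" "dQ (x + y) = dQ x + dQ y" "dQ (x - y) = dQ x - dQ y" "dQ (- x) = - dQ x"
  "dQ (scaleS c x) = scaleS c (dQ x)"
  by (transfer; simp add: free_der_simps rel_ideal_def ideal_gen.zero)+

lemma dQ_mult: "dQ (x * y) = dQ x * y + parity_aut x * dQ y"
  by transfer (simp add: free_der_mult rel_ideal_def ideal_gen.zero)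

definition Bdiv :: onshell where
  "Bdiv = (\<Sum>\<mu>\<in>UNIV. \<Sum>\<nu>\<in>UNIV. scaleS (eta \<mu> \<nu>) (tderiv \<mu> (field_v \<nu>)))"

text \<open>\<open>derivs [\<rho>\<^sub>1, \<dots>, \<rho>\<^sub>n]\<close> is the iterated total derivative.\<close>

definition derivs :: "4 list \<Rightarrow> onshell \<Rightarrow> onshell" where
  "derivs \<rho>s x = foldr tderiv \<rho>s x"

definition Fstr :: "4 \<Rightarrow> 4 \<Rightarrow> 4 list \<Rightarrow> onshell" where
  "Fstr \<mu> \<nu> \<rho>s = derivs \<rho>s (tderiv \<mu> (field_v \<nu>) - tderiv \<nu> (field_v \<mu>))"

definition omit :: "nat \<Rightarrow> 'a list \<Rightarrow> 'a list" where
  "omit l xs = take l xs @ drop (Suc l) xs"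

definition F0 :: "4 \<Rightarrow> 4 \<Rightarrow> 4 list \<Rightarrow> onshell" where
  "F0 \<mu> \<nu> \<rho>s = Fstr \<mu> \<nu> \<rho>s + scaleS (1 / of_nat (length \<rho>s + 2))
     (\<Sum>l<length \<rho>s. scaleS (eta \<mu> (\<rho>s ! l)) (derivs (\<nu> # omit l \<rho>s) Bdiv)
                      - scaleS (eta \<nu> (\<rho>s ! l)) (derivs (\<mu> # omit l \<rho>s) Bdiv))"

subsection \<open>The defining properties of the differential\<close>

lemma genS_brs:
  "dQ (genS (Vj \<mu> R)) = scaleS \<i> (genS (Uj (add_mset \<mu> R)))"
  "dQ (genS (Uj R)) = 0"
  by (transfer; simp add: free_der_gen rel_ideal_def ideal_gen.zero)+

lemma abs_salg_simps:
  "abs_salg 0 = 0" "abs_salg (p + q) = abs_salg p + abs_salg q"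
  "abs_salg (cst c * p) = scaleS c (abs_salg p)" "abs_salg (gen g) = genS g"
  by (simp_all add: zero_salg.abs_eq plus_salg.abs_eq scaleS.abs_eq genS.abs_eq)

lemma abs_salg_sum: "abs_salg (sum f A) = (\<Sum>a\<in>A. abs_salg (f a))"
  by (induction A rule: infinite_finite_induct) (simp_all add: abs_salg_simps)

definition Bj :: "4 multiset \<Rightarrow> onshell" where
  "Bj R = (\<Sum>\<mu>\<in>UNIV. \<Sum>\<nu>\<in>UNIV. scaleS (eta \<mu> \<nu>) (genS (Vj \<nu> (add_mset \<mu> R))))"

lemma dQ_genS_Tj: "dQ (genS (Tj R)) = scaleS (- \<i>) (Bj R)"
proof -
  have "dQ (genS (Tj R)) = abs_salg (brs (Tj R))"
    by (simp add: genS_def dQ.abs_eq free_der_gen)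
  then show ?thesis
    by (simp only: brs.simps div_jet_def abs_salg_simps abs_salg_sum Bj_def)
qed

lemma B_eq: "Bdiv = Bj {#}"
  by (simp add: Bdiv_def Bj_def field_v_def tderiv_genS)

lemma tderiv_Bj: "tderiv \<mu> (Bj R) = Bj (add_mset \<mu> R)"
  by (simp add: Bj_def tderiv_sum tderiv_simps tderiv_genS add_mset_commute)

lemma dQ_v: "dQ (field_v \<mu>) = scaleS \<i> (tderiv \<mu> field_u)"
  by (simp add: field_v_def field_u_def genS_brs tderiv_genS)

lemma dQ_u: "dQ field_u = 0"
  by (simp add: field_u_def genS_brs)

lemma dQ_ut: "dQ field_ut = scaleS (- \<i>) Bdiv"
  by (simp add: field_ut_def dQ_genS_Tj B_eq)

lemma salg_induct [case_names zero one gen add]: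
  fixes x :: "'g::presented salg"
  assumes "P 0" "\<And>c. P (scaleS c 1)" "\<And>g x. P x \<Longrightarrow> P (genS g * x)"
    "\<And>x y. P x \<Longrightarrow> P y \<Longrightarrow> P (x + y)"
  shows "P x"
proof -
  obtain p where x: "x = abs_salg p"
    using Quotient_abs_rep[OF Quotient_salg, of x] by metis
  have "P (scaleS c (abs_salg (monomial w)))" for c w
  proof (induction w)
    case Nil
    show ?case using assms(2)[of c] by (simp add: one_salg.abs_eq)
  next
    case (Cons g w)
    have "scaleS c (abs_salg (monomial (g # w))) = genS g * scaleS c (abs_salg (monomial w))"
      by (simp add: monomial_Cons times_salg.abs_eq[symmetric] abs_salg_simps scaleS_mult_right)
    then show ?case using assms(3)[OF Cons.IH] by simp
  qed
  then have "P (abs_salg p)"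
    by (induction p rule: free_induct) (simp_all add: abs_salg_simps assms)
  then show ?thesis by (simp add: x)
qed

lemma parity_aut_genS: "parity_aut (genS g) = scaleS (if odd_gen g then -1 else 1) (genS g)"
  by transfer (simp add: free_twist_gen parity_sign_def rel_ideal_def ideal_gen.zero)

lemma tderiv_one: "tderiv \<mu> 1 = 0" and dQ_one: "dQ 1 = 0"
proof -
  show "tderiv \<mu> 1 = 0" using tderiv_mult[of \<mu> 1 1] by simp
  show "dQ 1 = 0"
    by transfer (use free_der_cst[of True brs 1] in \<open>simp add: rel_ideal_def ideal_gen.zero\<close>)
qed

lemma odd_gen_shift: "odd_gen (shift \<mu> g) = odd_gen g"
  by (cases g) auto

lemma parity_aut_tderiv_genS: "parity_aut (tderiv \<mu> (genS g)) = tderiv \<mu> (parity_aut (genS g))"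
  by (simp add: tderiv_genS parity_aut_genS tderiv_simps odd_gen_shift)

lemma dQ_tderiv: "dQ (tderiv \<mu> x) = tderiv \<mu> (dQ x)"
proof (induction x rule: salg_induct)
  case (gen g x)
  have "dQ (tderiv \<mu> (genS g)) = tderiv \<mu> (dQ (genS g))"
    by (cases g) (simp_all add: tderiv_genS genS_brs tderiv_simps dQ_genS_Tj tderiv_Bj add_mset_commute)
  then show ?case
    by (simp add: tderiv_mult dQ_mult dQ_simps tderiv_simps gen parity_aut_tderiv_genS algebra_simps)
qed (simp_all add: tderiv_simps dQ_simps tderiv_one dQ_one)

subsection \<open>Index properties of the corrected field strengths\<close>

lemma box_genS: "j \<in> range Vj \<union> {Uj, Tj} \<Longrightarrow>
  (\<Sum>\<mu>\<in>UNIV. \<Sum>\<nu>\<in>UNIV. scaleS (eta \<mu> \<nu>) (genS (j (add_mset \<mu> (add_mset \<nu> R))))) = 0"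
proof -
  assume "j \<in> range Vj \<union> {Uj, Tj}"
  then have "abs_salg (box j R) = 0"
    using box_rel_ideal[of j R] by (simp add: zero_salg.abs_eq salg.abs_eq_iff)
  then show ?thesis
    by (simp add: box_def abs_salg_sum abs_salg_simps)
qed

lemma parity_aut_simps:
  "parity_aut 0 = 0" "parity_aut (- x) = - parity_aut x" "parity_aut (x + y) = parity_aut x + parity_aut y"
  "parity_aut (scaleS c x) = scaleS c (parity_aut x)"
  by (transfer; simp add: free_twist_simps rel_ideal_def ideal_gen.zero)+

lemma parity_aut_Bj: "parity_aut (Bj R) = Bj R"
proof -
  have "parity_aut (sum f A) = (\<Sum>a\<in>A. parity_aut (f a))" for f :: "4 \<Rightarrow> onshell" and A
    by (induction A rule: infinite_finite_induct) (simp_all add: parity_aut_simps)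
  then show ?thesis by (simp add: Bj_def parity_aut_simps parity_aut_genS)
qed

lemma dQ_Bj: "dQ (Bj R) = 0"
proof -
  have "dQ (sum f A) = (\<Sum>a\<in>A. dQ (f a))" for f :: "4 \<Rightarrow> onshell" and A
    by (induction A rule: infinite_finite_induct) (simp_all add: dQ_simps)
  then have "dQ (Bj R) = scaleS \<i>
      (\<Sum>\<mu>\<in>UNIV. \<Sum>\<nu>\<in>UNIV. scaleS (eta \<mu> \<nu>) (genS (Uj (add_mset \<mu> (add_mset \<nu> R)))))"
    by (simp add: Bj_def dQ_simps genS_brs scaleS.scale_sum_right mult.commute add_mset_commute)
  then show ?thesis by (simp add: box_genS)
qed

lemma dQ_dQ: "dQ (dQ x) = 0"
proof (induction x rule: salg_induct)
  case (gen g x)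
  have "dQ (dQ (genS g)) = 0"
    by (cases g) (simp_all add: genS_brs dQ_simps dQ_genS_Tj dQ_Bj)
  moreover have "parity_aut (dQ (genS g)) = - dQ (parity_aut (genS g))"
    by (cases g) (simp_all add: genS_brs dQ_simps dQ_genS_Tj parity_aut_genS parity_aut_simps
        parity_aut_Bj)
  ultimately show ?case
    by (simp add: dQ_mult dQ_simps gen)
qed (simp_all add: dQ_simps dQ_one)

lemma derivs_V: "derivs \<rho>s (genS (Vj \<nu> R)) = genS (Vj \<nu> (R + mset \<rho>s))"
  by (induction \<rho>s) (simp_all add: derivs_def tderiv_genS)

lemma derivs_diff: "derivs \<rho>s (x - y) = derivs \<rho>s x - derivs \<rho>s y"
  by (induction \<rho>s) (simp_all add: derivs_def tderiv_simps)

lemma derivs_B: "derivs \<rho>s Bdiv = Bj (mset \<rho>s)"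
  by (induction \<rho>s) (simp_all add: derivs_def B_eq tderiv_Bj)

lemma Fstr_eq: "Fstr \<mu> \<nu> \<rho>s = genS (Vj \<nu> (add_mset \<mu> (mset \<rho>s))) - genS (Vj \<mu> (add_mset \<nu> (mset \<rho>s)))"
  by (simp add: Fstr_def field_v_def tderiv_genS derivs_diff derivs_V)

lemma mset_omit: "l < length xs \<Longrightarrow> mset (omit l xs) = mset xs - {#xs ! l#}"
  by (subst (2) id_take_nth_drop[of l xs]) (simp_all add: omit_def)

lemma F0_eq: "F0 \<mu> \<nu> \<rho>s =
  genS (Vj \<nu> (add_mset \<mu> (mset \<rho>s))) - genS (Vj \<mu> (add_mset \<nu> (mset \<rho>s)))
  + scaleS (1 / of_nat (size (mset \<rho>s) + 2))
     (\<Sum>\<rho>\<in>#mset \<rho>s. scaleS (eta \<mu> \<rho>) (Bj (add_mset \<nu> (mset \<rho>s - {#\<rho>#})))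
                    - scaleS (eta \<nu> \<rho>) (Bj (add_mset \<mu> (mset \<rho>s - {#\<rho>#}))))"
proof -
  have "(\<Sum>\<rho>\<in>#mset \<rho>s. f \<rho> (mset \<rho>s - {#\<rho>#})) = (\<Sum>l<length \<rho>s. f (\<rho>s ! l) (mset (omit l \<rho>s)))"
    for f :: "4 \<Rightarrow> 4 multiset \<Rightarrow> onshell"
    unfolding mset_map[symmetric] sum_mset_sum_list sum_list_sum_nth
    by (simp add: mset_omit atLeast0LessThan)
  from this[of "\<lambda>\<rho> M. scaleS (eta \<mu> \<rho>) (Bj (add_mset \<nu> M)) - scaleS (eta \<nu> \<rho>) (Bj (add_mset \<mu> M))"]
  show ?thesis
    by (simp add: F0_def Fstr_eq derivs_B)
qed

lemma F0_mset_cong: "mset \<rho>s = mset \<rho>s' \<Longrightarrow> F0 \<mu> \<nu> \<rho>s = F0 \<mu> \<nu> \<rho>s'"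
  by (simp add: F0_eq del: size_mset)

lemma F0_antisym: "F0 \<mu> \<nu> \<rho>s = - F0 \<nu> \<mu> \<rho>s"
proof -
  have "F0 \<mu> \<nu> \<rho>s + F0 \<nu> \<mu> \<rho>s = 0"
    by (simp add: F0_def Fstr_eq scaleS.scale_right_distrib[symmetric] sum.distrib[symmetric])
  then show ?thesis by (simp add: eq_neg_iff_add_eq_0)
qed

lemma eta_sum: "(\<Sum>\<nu>\<in>UNIV. scaleS (eta \<mu> \<nu>) (f \<nu>)) = scaleS (eta \<mu> \<mu>) (f \<mu>)"
proof -
  have "(\<Sum>\<nu>\<in>UNIV. scaleS (eta \<mu> \<nu>) (f \<nu>)) = (\<Sum>\<nu>\<in>UNIV. if \<nu> = \<mu> then scaleS (eta \<mu> \<mu>) (f \<mu>) else 0)"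
    by (intro sum.cong) (auto simp: eta_def)
  then show ?thesis by simp
qed

lemma eta_sq: "eta \<mu> \<mu> * eta \<mu> \<mu> = 1"
  by (simp add: eta_def)

lemma eta_sum_eta: "(\<Sum>\<nu>\<in>UNIV. scaleS (eta \<nu> \<nu>) (scaleS (eta \<nu> \<rho>) (f \<nu>))) = f \<rho>"
proof -
  have "(\<Sum>\<nu>\<in>UNIV. scaleS (eta \<nu> \<nu>) (scaleS (eta \<nu> \<rho>) (f \<nu>))) = (\<Sum>\<nu>\<in>UNIV. if \<nu> = \<rho> then f \<rho> else 0)"
    by (intro sum.cong) (auto simp: eta_def)
  then show ?thesis by simp
qed

lemma eta_sum_eta': "(\<Sum>\<nu>\<in>UNIV. scaleS (eta \<nu> \<nu>) (scaleS (eta \<rho> \<nu>) (f \<nu>))) = f \<rho>"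
proof -
  have "eta \<rho> \<nu> = eta \<nu> \<rho>" for \<nu> by (auto simp: eta_def)
  then show ?thesis using eta_sum_eta[of \<rho> f] by simp
qed

lemma Bj_diag: "Bj R = (\<Sum>\<mu>\<in>UNIV. scaleS (eta \<mu> \<mu>) (genS (Vj \<mu> (add_mset \<mu> R))))"
  by (simp add: Bj_def eta_sum)

lemma box_diag: "(\<Sum>\<mu>\<in>UNIV. scaleS (eta \<mu> \<mu>) (genS (Vj \<kappa> (add_mset \<mu> (add_mset \<mu> R))))) = 0"
  using box_genS[of "Vj \<kappa>" R] by (simp add: eta_sum)

lemma box_Bj: "(\<Sum>\<mu>\<in>UNIV. scaleS (eta \<mu> \<mu>) (Bj (add_mset \<mu> (add_mset \<mu> R)))) = 0"
proof -
  have "(\<Sum>\<mu>\<in>UNIV. scaleS (eta \<mu> \<mu>) (Bj (add_mset \<mu> (add_mset \<mu> R)))) =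
    (\<Sum>\<kappa>\<in>UNIV. scaleS (eta \<kappa> \<kappa>)
       (\<Sum>\<mu>\<in>UNIV. scaleS (eta \<mu> \<mu>) (genS (Vj \<kappa> (add_mset \<mu> (add_mset \<mu> (add_mset \<kappa> R)))))))"
    unfolding Bj_diag scaleS.scale_sum_right
    by (subst sum.swap) (simp add: mult.commute add_mset_commute)
  then show ?thesis by (simp add: box_diag)
qed

lemma omit_Cons: "omit 0 (x # xs) = xs" "omit (Suc l) (x # xs) = x # omit l xs"
  by (simp_all add: omit_def)

lemma add_mset_omit: "l < length xs \<Longrightarrow> add_mset (xs ! l) (mset (omit l xs)) = mset xs"
  by (simp add: mset_omit)

lemma F0_trace1: "(\<Sum>\<mu>\<in>UNIV. \<Sum>\<rho>\<in>UNIV. scaleS (eta \<mu> \<rho>) (F0 \<mu> \<nu> (\<rho> # \<rho>s))) = 0"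
proof -
  define M where "M = mset \<rho>s"
  define n where "n = length \<rho>s"
  define X where "X = Bj (add_mset \<nu> M)"
  define G where "G \<mu> = (\<Sum>l<n. scaleS (eta \<mu> (\<rho>s ! l)) (Bj (add_mset \<nu> (add_mset \<mu> (mset (omit l \<rho>s)))))
      - scaleS (eta \<nu> (\<rho>s ! l)) (Bj (add_mset \<mu> (add_mset \<mu> (mset (omit l \<rho>s))))))" for \<mu>
  have F0: "F0 \<mu> \<nu> (\<mu> # \<rho>s) =
     genS (Vj \<nu> (add_mset \<mu> (add_mset \<mu> M))) - genS (Vj \<mu> (add_mset \<mu> (add_mset \<nu> M)))
     + scaleS (1 / of_nat (n + 3))
       (scaleS (eta \<mu> \<mu>) X - scaleS (eta \<nu> \<mu>) (Bj (add_mset \<mu> M)) + G \<mu>)" for \<mu>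
    by (simp add: F0_def Fstr_eq derivs_B sum.lessThan_Suc_shift omit_Cons G_def X_def M_def n_def
        add_mset_commute del: sum.lessThan_Suc)
  have G: "(\<Sum>\<mu>\<in>UNIV. scaleS (eta \<mu> \<mu>) (G \<mu>)) = scaleS (of_nat n) X"
  proof -
    have "(\<Sum>\<mu>\<in>UNIV. scaleS (eta \<mu> \<mu>) (G \<mu>)) = (\<Sum>l<n.
        (\<Sum>\<mu>\<in>UNIV. scaleS (eta \<mu> \<mu>) (scaleS (eta \<mu> (\<rho>s ! l)) (Bj (add_mset \<nu> (add_mset \<mu> (mset (omit l \<rho>s)))))))
      - scaleS (eta \<nu> (\<rho>s ! l))
          (\<Sum>\<mu>\<in>UNIV. scaleS (eta \<mu> \<mu>) (Bj (add_mset \<mu> (add_mset \<mu> (mset (omit l \<rho>s)))))))"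
      unfolding G_def scaleS.scale_sum_right sum_subtractf[symmetric]
      by (subst sum.swap) (simp add: scaleS.scale_right_diff_distrib mult.commute)
    also have "\<dots> = (\<Sum>l<n. X)"
      by (intro sum.cong) (simp_all only: eta_sum_eta box_Bj, simp_all add: add_mset_omit X_def M_def n_def)
    also have "\<dots> = scaleS (of_nat n) X"
      by (induction n) (simp_all add: scaleS.scale_left_distrib)
    finally show ?thesis .
  qed
  have "(\<Sum>\<mu>\<in>(UNIV :: 4 set). X) = scaleS (\<Sum>\<mu>\<in>(UNIV :: 4 set). 1) X"
    by (simp only: scaleS.scale_sum_left scaleS.scale_one)
  then have C: "(\<Sum>\<mu>\<in>UNIV. scaleS (eta \<mu> \<mu>) (scaleS (eta \<mu> \<mu>) X)) = scaleS 4 X"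
    by (simp add: eta_sq)
  have E: "(\<Sum>\<mu>\<in>UNIV. scaleS (eta \<mu> \<mu>) (scaleS (eta \<nu> \<mu>) (Bj (add_mset \<mu> M)))) = X"
    by (simp only: eta_sum_eta' X_def)
  have "(\<Sum>\<mu>\<in>UNIV. scaleS (eta \<mu> \<mu>) (F0 \<mu> \<nu> (\<mu> # \<rho>s))) =
      (\<Sum>\<mu>\<in>UNIV. scaleS (eta \<mu> \<mu>) (genS (Vj \<nu> (add_mset \<mu> (add_mset \<mu> M)))))
    - (\<Sum>\<mu>\<in>UNIV. scaleS (eta \<mu> \<mu>) (genS (Vj \<mu> (add_mset \<mu> (add_mset \<nu> M)))))
    + scaleS (1 / of_nat (n + 3))
       ((\<Sum>\<mu>\<in>UNIV. scaleS (eta \<mu> \<mu>) (scaleS (eta \<mu> \<mu>) X))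
        - (\<Sum>\<mu>\<in>UNIV. scaleS (eta \<mu> \<mu>) (scaleS (eta \<nu> \<mu>) (Bj (add_mset \<mu> M))))
        + (\<Sum>\<mu>\<in>UNIV. scaleS (eta \<mu> \<mu>) (G \<mu>)))"
    unfolding F0 scaleS.scale_right_distrib scaleS.scale_right_diff_distrib scaleS.scale_sum_right
      sum.distrib sum_subtractf
    by (simp add: mult.commute)
  also have "\<dots> = - X + scaleS (1 / of_nat (n + 3)) (scaleS 4 X - X + scaleS (of_nat n) X)"
    unfolding C E G by (simp add: box_diag Bj_diag[symmetric] X_def)
  also have "scaleS 4 X - X + scaleS (of_nat n) X = scaleS (of_nat (n + 3)) X"
  proof -
    have "scaleS 4 X - X + scaleS (of_nat n) X = scaleS (4 - 1 + of_nat n) X"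
      by (simp only: scaleS.scale_left_distrib scaleS.scale_left_diff_distrib scaleS.scale_one)
    also have "4 - 1 + of_nat n = (of_nat (n + 3) :: complex)" by simp
    finally show ?thesis .
  qed
  also have "- X + scaleS (1 / of_nat (n + 3)) (scaleS (of_nat (n + 3)) X) = 0"
    by (simp del: of_nat_add)
  finally show ?thesis by (simp add: eta_sum)
qed

lemma F0_trace2: "(\<Sum>\<rho>\<in>UNIV. \<Sum>\<sigma>\<in>UNIV. scaleS (eta \<rho> \<sigma>) (F0 \<mu> \<nu> (\<rho> # \<sigma> # \<rho>s))) = 0"
proof -
  define M where "M = mset \<rho>s"
  define n where "n = length \<rho>s"
  define G where "G \<rho> = (\<Sum>l<n.
      scaleS (eta \<mu> (\<rho>s ! l)) (Bj (add_mset \<rho> (add_mset \<rho> (add_mset \<nu> (mset (omit l \<rho>s))))))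
      - scaleS (eta \<nu> (\<rho>s ! l)) (Bj (add_mset \<rho> (add_mset \<rho> (add_mset \<mu> (mset (omit l \<rho>s)))))))" for \<rho>
  define D where "D \<rho> = scaleS (eta \<mu> \<rho>) (Bj (add_mset \<nu> (add_mset \<rho> M)))
      - scaleS (eta \<nu> \<rho>) (Bj (add_mset \<mu> (add_mset \<rho> M)))" for \<rho>
  have F0: "F0 \<mu> \<nu> (\<rho> # \<rho> # \<rho>s) =
     genS (Vj \<nu> (add_mset \<rho> (add_mset \<rho> (add_mset \<mu> M))))
     - genS (Vj \<mu> (add_mset \<rho> (add_mset \<rho> (add_mset \<nu> M))))
     + scaleS (1 / of_nat (Suc (Suc n) + 2)) (D \<rho> + (D \<rho> + G \<rho>))" for \<rho>
    by (simp add: F0_def Fstr_eq derivs_B sum.lessThan_Suc_shift omit_Cons G_def D_def M_def n_def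
        add_mset_commute del: sum.lessThan_Suc)
  have G: "(\<Sum>\<rho>\<in>UNIV. scaleS (eta \<rho> \<rho>) (G \<rho>)) = 0"
  proof -
    have "(\<Sum>\<rho>\<in>UNIV. scaleS (eta \<rho> \<rho>) (G \<rho>)) = (\<Sum>l<n.
        scaleS (eta \<mu> (\<rho>s ! l)) (\<Sum>\<rho>\<in>UNIV. scaleS (eta \<rho> \<rho>)
          (Bj (add_mset \<rho> (add_mset \<rho> (add_mset \<nu> (mset (omit l \<rho>s)))))))
      - scaleS (eta \<nu> (\<rho>s ! l)) (\<Sum>\<rho>\<in>UNIV. scaleS (eta \<rho> \<rho>)
          (Bj (add_mset \<rho> (add_mset \<rho> (add_mset \<mu> (mset (omit l \<rho>s))))))))"
      unfolding G_def scaleS.scale_sum_right sum_subtractf[symmetric]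
      by (subst sum.swap) (simp add: scaleS.scale_right_diff_distrib mult.commute)
    then show ?thesis by (simp add: box_Bj)
  qed
  have D: "(\<Sum>\<rho>\<in>UNIV. scaleS (eta \<rho> \<rho>) (D \<rho>)) = 0"
    unfolding D_def scaleS.scale_right_diff_distrib sum_subtractf eta_sum_eta'
    by (simp add: add_mset_commute)
  have "(\<Sum>\<rho>\<in>UNIV. scaleS (eta \<rho> \<rho>) (F0 \<mu> \<nu> (\<rho> # \<rho> # \<rho>s))) =
      (\<Sum>\<rho>\<in>UNIV. scaleS (eta \<rho> \<rho>) (genS (Vj \<nu> (add_mset \<rho> (add_mset \<rho> (add_mset \<mu> M))))))
    - (\<Sum>\<rho>\<in>UNIV. scaleS (eta \<rho> \<rho>) (genS (Vj \<mu> (add_mset \<rho> (add_mset \<rho> (add_mset \<nu> M))))))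
    + scaleS (1 / of_nat (Suc (Suc n) + 2))
       ((\<Sum>\<rho>\<in>UNIV. scaleS (eta \<rho> \<rho>) (D \<rho>)) + ((\<Sum>\<rho>\<in>UNIV. scaleS (eta \<rho> \<rho>) (D \<rho>))
        + (\<Sum>\<rho>\<in>UNIV. scaleS (eta \<rho> \<rho>) (G \<rho>))))"
    unfolding F0 scaleS.scale_right_distrib scaleS.scale_right_diff_distrib scaleS.scale_sum_right
      sum.distrib sum_subtractf
    by (simp add: mult.commute)
  then show ?thesis by (simp add: eta_sum box_diag D G)
qed


section \<open>Polynomials in \<open>u\<close> and the corrected field strengths\<close>

text \<open>Formal polynomials in symbols for \<open>u\<close> and $F^{(0)}_{\mu\nu;\rho_1,\dots,\rho_n}$. The relators express
  antisymmetry in \<open>\<mu>, \<nu>\<close>, symmetry in the derivative indices and tracelessness; the Bianchi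
  identities are not among them.\<close>

datatype fsym = Us | Fs 4 4 "4 list"

instantiation fsym :: presented
begin
definition odd_gen_fsym :: "fsym \<Rightarrow> bool" where "odd_gen_fsym g \<longleftrightarrow> g = Us"
definition relators_fsym :: "fsym free set" where
  "relators_fsym =
     {gen (Fs \<mu> \<nu> \<rho>s) + gen (Fs \<nu> \<mu> \<rho>s) | \<mu> \<nu> \<rho>s. True}
   \<union> {gen (Fs \<mu> \<nu> \<rho>s) - gen (Fs \<mu> \<nu> \<rho>s') | \<mu> \<nu> \<rho>s \<rho>s'. mset \<rho>s = mset \<rho>s'}
   \<union> {(\<Sum>\<mu>\<in>UNIV. \<Sum>\<rho>\<in>UNIV. cst (eta \<mu> \<rho>) * gen (Fs \<mu> \<nu> (\<rho> # \<rho>s))) | \<nu> \<rho>s. True}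
   \<union> {(\<Sum>\<rho>\<in>UNIV. \<Sum>\<sigma>\<in>UNIV. cst (eta \<rho> \<sigma>) * gen (Fs \<mu> \<nu> (\<rho> # \<sigma> # \<rho>s))) | \<mu> \<nu> \<rho>s. True}"
instance ..
end

fun sym_val :: "fsym \<Rightarrow> onshell" where
  "sym_val Us = field_u"
| "sym_val (Fs \<mu> \<nu> \<rho>s) = F0 \<mu> \<nu> \<rho>s"

lemma F0_commute:
  assumes "\<And>\<kappa> R. y * genS (Vj \<kappa> R) = genS (Vj \<kappa> R) * y"
  shows "y * F0 \<mu> \<nu> \<rho>s = F0 \<mu> \<nu> \<rho>s * y"
proof -
  have "y * Bj R = Bj R * y" for R
    by (simp add: Bj_diag sum_distrib_left sum_distrib_right scaleS_mult_left scaleS_mult_right assms)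
  then show ?thesis
    by (simp add: F0_def Fstr_eq derivs_B distrib_left distrib_right left_diff_distrib
        right_diff_distrib sum_distrib_left sum_distrib_right scaleS_mult_left scaleS_mult_right assms)
qed

lemma F0_central_genS: "genS j * F0 \<mu> \<nu> \<rho>s = F0 \<mu> \<nu> \<rho>s * genS j"
  by (rule F0_commute) (subst genS_graded_comm, simp)

lemma sym_val_graded_comm:
  "sym_val g * sym_val h = scaleS (if odd_gen g \<and> odd_gen h then -1 else 1) (sym_val h * sym_val g)"
proof (cases g; cases h)
  fix \<mu> \<nu> \<rho>s \<mu>' \<nu>' \<rho>s'
  assume gh: "g = Fs \<mu> \<nu> \<rho>s" "h = Fs \<mu>' \<nu>' \<rho>s'"
  have "F0 \<mu> \<nu> \<rho>s * F0 \<mu>' \<nu>' \<rho>s' = F0 \<mu>' \<nu>' \<rho>s' * F0 \<mu> \<nu> \<rho>s"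
    by (rule F0_commute) (simp add: F0_central_genS)
  with gh show ?thesis by (simp add: odd_gen_fsym_def)
next
  assume gh: "g = Us" "h = Us"
  have "field_u * field_u = scaleS (-1) (field_u * field_u)"
    unfolding field_u_def by (subst genS_graded_comm) simp
  with gh show ?thesis by (simp add: odd_gen_fsym_def)
qed (simp_all add: odd_gen_fsym_def field_u_def F0_central_genS)

text \<open>Substitution of $u$ and $F^{(0)}$ for the symbols.\<close>

lift_definition subst_sym :: "fsym salg \<Rightarrow> onshell" is "free_subst sym_val"
proof -
  fix p q :: "fsym free"
  assume "p - q \<in> rel_ideal"
  then have "free_subst sym_val (p - q) = 0"
  proof (rule free_subst_ideal[OF sym_val_graded_comm, rotated])
    fix r :: "fsym free" assume "r \<in> relators"
    moreover have "F0 \<mu> \<nu> \<rho>s + F0 \<nu> \<mu> \<rho>s = 0" for \<mu> \<nu> \<rho>s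
      using F0_antisym[of \<mu> \<nu> \<rho>s] by simp
    moreover have "F0 \<mu> \<nu> \<rho>s - F0 \<mu> \<nu> \<rho>s' = 0" if "mset \<rho>s = mset \<rho>s'" for \<mu> \<nu> \<rho>s \<rho>s'
      using F0_mset_cong[OF that, of \<mu> \<nu>] by simp
    ultimately show "free_subst sym_val r = 0"
      by (auto simp only: relators_fsym_def Un_iff mem_Collect_eq free_subst_simps free_subst_gen
          sym_val.simps F0_trace1 F0_trace2)
  qed
  then show "free_subst sym_val p = free_subst sym_val q"
    by (simp add: free_subst_simps)
qed

definition P0 :: "onshell set" where "P0 = range subst_sym"

definition bianchi_ideal :: "fsym salg set" where
  "bianchi_ideal = ideal_gen {genS (Fs \<mu> \<nu> (\<rho> # \<sigma>s)) + genS (Fs \<nu> \<rho> (\<mu> # \<sigma>s))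
     + genS (Fs \<rho> \<mu> (\<nu> # \<sigma>s)) | \<mu> \<nu> \<rho> \<sigma>s. True}"

lemma ideal_gen_scaleS: "x \<in> ideal_gen R \<Longrightarrow> scaleS c x \<in> ideal_gen R"
  using ideal_gen_lmult[of x R "scaleS c 1"] by (simp add: scaleS_mult_left)

text \<open>Inside \<open>onshell\<close> the Bianchi identities hold identically, so they are imposed on the formal
  polynomials: this type is the space of polynomials in \<open>u\<close> and $F^{(0)}$ factorized by the Bianchi
  identities and their derivatives.\<close>

quotient_type P0_bianchi = "fsym salg" / "\<lambda>x y. x - y \<in> bianchi_ideal"
  unfolding bianchi_ideal_def by (rule ideal_gen_equivp)

instantiation P0_bianchi :: ab_group_add
begin
lift_definition zero_P0_bianchi :: P0_bianchi is 0 .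
lift_definition plus_P0_bianchi :: "P0_bianchi \<Rightarrow> P0_bianchi \<Rightarrow> P0_bianchi" is "(+)"
  unfolding bianchi_ideal_def add_diff_add by (rule ideal_gen.add)
lift_definition uminus_P0_bianchi :: "P0_bianchi \<Rightarrow> P0_bianchi" is uminus
  unfolding bianchi_ideal_def minus_diff_minus by (rule ideal_gen_uminus)
lift_definition minus_P0_bianchi :: "P0_bianchi \<Rightarrow> P0_bianchi \<Rightarrow> P0_bianchi" is "(-)"
proof -
  fix a b c d :: "fsym salg"
  assume "a - b \<in> bianchi_ideal" "c - d \<in> bianchi_ideal"
  then have "(a - b) - (c - d) \<in> bianchi_ideal" unfolding bianchi_ideal_def by (rule ideal_gen_diff)
  then show "(a - c) - (b - d) \<in> bianchi_ideal" by (simp add: algebra_simps)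
qed
instance
  by standard (transfer; simp add: algebra_simps bianchi_ideal_def ideal_gen.zero)+
end

lift_definition bianchi_scale :: "complex \<Rightarrow> P0_bianchi \<Rightarrow> P0_bianchi" is scaleS
  unfolding bianchi_ideal_def scaleS.scale_right_diff_distrib[symmetric] by (rule ideal_gen_scaleS)

definition bianchi_class :: "fsym salg \<Rightarrow> P0_bianchi" where "bianchi_class x = abs_P0_bianchi x"

lemma vector_space_bianchi_scale: "vector_space bianchi_scale"
  by unfold_locales
     (transfer; simp add: scaleS.scale_right_distrib scaleS.scale_left_distrib bianchi_ideal_def
       ideal_gen.zero)+


section \<open>Cohomology\<close>

definition Z_Q :: "onshell set" where "Z_Q = {p. dQ p = 0}"
definition B_Q :: "onshell set" where "B_Q = range dQ"

definition cohomologous :: "onshell \<Rightarrow> onshell \<Rightarrow> bool" where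
  "cohomologous p q \<longleftrightarrow> p \<in> Z_Q \<and> q \<in> Z_Q \<and> p - q \<in> B_Q"

lemma cohomologous_iff: "cohomologous p q \<longleftrightarrow> dQ p = 0 \<and> dQ q = 0 \<and> (\<exists>r. p = q + dQ r)"
  by (auto simp: cohomologous_def Z_Q_def B_Q_def image_iff algebra_simps)

lemma cohomologous_eqI: "dQ p = 0 \<Longrightarrow> p = q \<Longrightarrow> cohomologous p q"
  using dQ_simps(1) unfolding cohomologous_iff by (metis add_0_right)

lemma cohomologous_sym: "cohomologous p q \<Longrightarrow> cohomologous q p"
proof -
  assume "cohomologous p q"
  then obtain r where "dQ p = 0" "dQ q = 0" "p = q + dQ r"
    unfolding cohomologous_iff by blast
  moreover from this have "q = p + dQ (- r)" by (simp add: dQ_simps)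
  ultimately show ?thesis unfolding cohomologous_iff by blast
qed

lemma cohomologous_add:
  assumes "cohomologous a b" "cohomologous c d" shows "cohomologous (a + c) (b + d)"
proof -
  obtain r t where r: "dQ a = 0" "dQ b = 0" "dQ c = 0" "dQ d = 0" "a = b + dQ r" "c = d + dQ t"
    using assms unfolding cohomologous_iff by blast
  then have "a + c = b + d + dQ (r + t)" by (simp add: dQ_simps)
  moreover have "dQ (a + c) = 0" "dQ (b + d) = 0" using r(1-4) by (simp_all add: dQ_simps)
  ultimately show ?thesis unfolding cohomologous_iff by blast
qed

lemma cohomologous_scale:
  assumes "cohomologous a b" shows "cohomologous (scaleS c a) (scaleS c b)"
proof -
  obtain r where r: "dQ a = 0" "dQ b = 0" "a = b + dQ r"
    using assms unfolding cohomologous_iff by blast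
  have "scaleS c a = scaleS c b + dQ (scaleS c r)"
    unfolding r(3) by (simp add: dQ_simps scaleS.scale_right_distrib)
  moreover have "dQ (scaleS c a) = 0" "dQ (scaleS c b) = 0" using r(1,2) by (simp_all add: dQ_simps)
  ultimately show ?thesis unfolding cohomologous_iff by blast
qed

lemma cohomologous_uminus: "cohomologous a b \<Longrightarrow> cohomologous (- a) (- b)"
  using cohomologous_scale[of a b "- 1"] by simp

text \<open>The relation is partial: its domain is \<open>Z_Q\<close>, so this type is $Z_Q / B_Q$.\<close>

quotient_type H_Q = onshell / partial: cohomologous
proof (rule part_equivpI)
  show "\<exists>p. cohomologous p p"
    using cohomologous_eqI[OF dQ_simps(1) refl] by blast
  show "symp cohomologous"
    by (rule sympI) (rule cohomologous_sym)
  show "transp cohomologous"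
  proof (rule transpI)
    fix x y z assume "cohomologous x y" "cohomologous y z"
    then show "cohomologous x z"
      using cohomologous_add[of x y y z] by (simp add: cohomologous_def)
  qed
qed

instantiation H_Q :: ab_group_add
begin
lift_definition zero_H_Q :: H_Q is 0
  by (rule cohomologous_eqI[OF dQ_simps(1) refl])
lift_definition plus_H_Q :: "H_Q \<Rightarrow> H_Q \<Rightarrow> H_Q" is "(+)"
  by (rule cohomologous_add)
lift_definition uminus_H_Q :: "H_Q \<Rightarrow> H_Q" is uminus
  by (rule cohomologous_uminus)
lift_definition minus_H_Q :: "H_Q \<Rightarrow> H_Q \<Rightarrow> H_Q" is "(-)"
  unfolding diff_conv_add_uminus by (intro cohomologous_add cohomologous_uminus)
instance
proof
  fix a b c :: H_Q
  show "a + b + c = a + (b + c)"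
    by transfer (rule cohomologous_eqI; simp add: cohomologous_iff dQ_simps add_ac)
  show "a + b = b + a"
    by transfer (rule cohomologous_eqI; simp add: cohomologous_iff dQ_simps add_ac)
  show "0 + a = a"
    by transfer (rule cohomologous_eqI; simp add: cohomologous_iff dQ_simps)
  show "- a + a = 0"
    by transfer (rule cohomologous_eqI; simp add: cohomologous_iff dQ_simps)
  show "a - b = a + - b"
    by transfer (rule cohomologous_eqI; simp add: cohomologous_iff dQ_simps)
qed
end

lift_definition H_scale :: "complex \<Rightarrow> H_Q \<Rightarrow> H_Q" is scaleS
  by (rule cohomologous_scale)

lemma vector_space_H_scale: "vector_space H_scale"
proof
  fix a b :: complex and x y :: H_Q
  show "H_scale a (x + y) = H_scale a x + H_scale a y"
    by transfer (rule cohomologous_eqI; simp add: cohomologous_iff dQ_simps scaleS.scale_right_distrib)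
  show "H_scale (a + b) x = H_scale a x + H_scale b x"
    by transfer (rule cohomologous_eqI; simp add: cohomologous_iff dQ_simps scaleS.scale_left_distrib)
  show "H_scale a (H_scale b x) = H_scale (a * b) x"
    by transfer (rule cohomologous_eqI; simp add: cohomologous_iff dQ_simps)
  show "H_scale 1 x = x"
    by transfer (rule cohomologous_eqI; simp add: cohomologous_iff dQ_simps)
qed

text \<open>Meaningful only for cocycles \<open>p\<close>.\<close>

definition coh_class :: "onshell \<Rightarrow> H_Q" where "coh_class p = abs_H_Q p"

end

theory Submission
  imports Defs
begin

text \<open>Sending $v_{\mu;R}$ with $|R| = n$ to $\frac{1}{n+1} \sum_{\rho \in R} F_{\rho\mu;R\setminus\rho}$,
  $u$ to $u$, and $\tilde u_R$ and the proper derivatives of $u$ to $0$ gives an algebra homomorphism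
  \<open>retract\<close> that kills $d_Q$-images and, modulo the Bianchi identities, is a left inverse of the
  substitution \<open>subst_sym\<close>. Hence a polynomial in $u$ and $F^{(0)}$ that is a coboundary vanishes
  modulo Bianchi.

  Conversely, there is an odd derivation $h$ (\<open>hQ\<close>), removing one derivative index, such that
  the derivation $L = d_Q h + h d_Q$ (\<open>lap\<close>) equals the identity minus the composite of \<open>subst_sym\<close>
  with \<open>retract\<close> on generators. So $L$ counts the generators complementary to $u$ and $F^{(0)}$:
  every polynomial is a sum of $L$-eigenvectors with eigenvalues $0, \dots, N$ whose component of
  eigenvalue $0$ is a polynomial in $u$ and $F^{(0)}$. On cocycles $1 - L/k$ is a change by a
  coboundary, and applying it for $k = N, \dots, 1$ removes all other components.\<close>

section \<open>Sums over a multiset with one index removed\<close>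

text \<open>\<open>f\<close> receives the removed index together with the remaining multiset, so
  that identities can be proved by induction on the index multiset through
  \<open>sum_del_add_mset\<close>.\<close>

definition sum_del :: "('a \<Rightarrow> 'a multiset \<Rightarrow> 'b::comm_monoid_add) \<Rightarrow> 'a multiset \<Rightarrow> 'b" where
  "sum_del f R = (\<Sum>\<rho>\<in>#R. f \<rho> (R - {#\<rho>#}))"

lemma sum_del_empty [simp]: "sum_del f {#} = 0"
  by (simp add: sum_del_def)

lemma sum_del_cong:
  assumes "\<And>\<rho> S. R = add_mset \<rho> S \<Longrightarrow> f \<rho> S = g \<rho> S"
  shows "sum_del f R = sum_del g R"
  unfolding sum_del_def
  by (rule arg_cong[of _ _ sum_mset], rule image_mset_cong) (simp add: assms)

lemma sum_del_add_mset:
  "sum_del f (add_mset a R) = f a R + sum_del (\<lambda>\<rho> S. f \<rho> (add_mset a S)) R"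
proof -
  have "(\<Sum>\<rho>\<in>#R. f \<rho> (add_mset a R - {#\<rho>#})) = (\<Sum>\<rho>\<in>#R. f \<rho> (add_mset a (R - {#\<rho>#})))"
    by (rule arg_cong[of _ _ sum_mset], rule image_mset_cong) (simp add: diff_add_mset_swap)
  then show ?thesis by (simp add: sum_del_def)
qed

lemma sum_del_zero [simp]: "sum_del (\<lambda>\<rho> S. 0) R = 0"
  by (simp add: sum_del_def)

lemma sum_del_add: "sum_del (\<lambda>\<rho> S. f \<rho> S + g \<rho> S) R = sum_del f R + sum_del g R"
  by (simp add: sum_del_def sum_mset.distrib)

lemma sum_del_additive:
  assumes "f 0 = 0" "\<And>x y. f (x + y) = f x + f y"
  shows "f (sum_del g R) = sum_del (\<lambda>\<rho> S. f (g \<rho> S)) R"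
proof -
  have "f (\<Sum>\<rho>\<in>#M. k \<rho>) = (\<Sum>\<rho>\<in>#M. f (k \<rho>))" for M k
    by (induction M) (simp_all add: assms)
  then show ?thesis by (simp add: sum_del_def)
qed

lemma sum_del_uminus:
  "sum_del (\<lambda>\<rho> S. - g \<rho> S) R = - sum_del (g :: 'a \<Rightarrow> 'a multiset \<Rightarrow> 'b::ab_group_add) R"
  by (rule sum_del_additive[symmetric]) simp_all

lemma sum_del_diff:
  "sum_del (\<lambda>\<rho> S. f \<rho> S - g \<rho> S) R =
     sum_del f R - sum_del (g :: 'a \<Rightarrow> 'a multiset \<Rightarrow> 'b::ab_group_add) R"
  using sum_del_add[of f "\<lambda>\<rho> S. - g \<rho> S" R] by (simp add: sum_del_uminus)

lemma sum_del_scaleS: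
  "sum_del (\<lambda>\<rho> S. scaleS c (g \<rho> S)) R = scaleS c (sum_del g R)"
  by (rule sum_del_additive[symmetric]) (simp_all add: scaleS.scale_right_distrib)

lemma sum_del_sum: "sum_del (\<lambda>\<rho> S. \<Sum>a\<in>A. f a \<rho> S) R = (\<Sum>a\<in>A. sum_del (f a) R)"
  by (induction A rule: infinite_finite_induct) (simp_all add: sum_del_add)

text \<open>Putting the removed index back restores \<open>R\<close> in every term, so the sum
  merely counts the entries of \<open>R\<close>.\<close>

lemma sum_del_const:
  "sum_del (\<lambda>\<rho> S. X (add_mset \<rho> S)) R = scaleS (of_nat (size R)) (X R)"
proof -
  have "(\<Sum>\<rho>\<in>#M. x) = scaleS (of_nat (size M)) x" for M :: "'b multiset" and x :: "'a salg"
    by (induction M) (simp_all add: scaleS.scale_left_distrib)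
  moreover have "sum_del (\<lambda>\<rho> S. X (add_mset \<rho> S)) R = sum_del (\<lambda>\<rho> S. X R) R"
    by (rule sum_del_cong) simp
  ultimately show ?thesis by (simp add: sum_del_def)
qed

text \<open>Both sides run over ordered pairs of entries of \<open>R\<close>. In the induction step
  the terms that remove the new entry first and those that remove it second trade places.\<close>

lemma sum_del_swap:
  "sum_del (\<lambda>\<rho> S. sum_del (\<lambda>\<sigma> T. f \<rho> \<sigma> T) S) R = sum_del (\<lambda>\<rho> S. sum_del (\<lambda>\<sigma> T. f \<sigma> \<rho> T) S) R"
proof (induction R arbitrary: f)
  case (add a R)
  show ?case
    by (simp add: sum_del_add_mset sum_del_add
        add.IH[of "\<lambda>\<rho> \<sigma> T. f \<rho> \<sigma> (add_mset a T)"] add_ac)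
qed simp

section \<open>Metric traces\<close>

definition trace :: "(4 \<Rightarrow> 'g::presented salg) \<Rightarrow> 'g salg" where
  "trace f = (\<Sum>\<mu>\<in>UNIV. scaleS (eta \<mu> \<mu>) (f \<mu>))"

lemma trace_eq: "(\<Sum>\<mu>\<in>UNIV. \<Sum>\<nu>\<in>UNIV. scaleS (eta \<mu> \<nu>) (f \<mu> \<nu>)) = trace (\<lambda>\<mu>. f \<mu> \<mu>)"
proof -
  have "(\<Sum>\<nu>\<in>UNIV. scaleS (eta \<mu> \<nu>) (f \<mu> \<nu>)) = scaleS (eta \<mu> \<mu>) (f \<mu> \<mu>)" for \<mu>
    by (subst sum.remove[of _ \<mu>]) (auto simp: eta_def intro!: sum.neutral)
  then show ?thesis by (simp add: trace_def)
qed

lemma trace_zero [simp]: "trace (\<lambda>\<mu>. 0) = 0"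
  by (simp add: trace_def)

lemma trace_add: "trace (\<lambda>\<mu>. f \<mu> + g \<mu>) = trace f + trace g"
  by (simp add: trace_def scaleS.scale_right_distrib sum.distrib)

lemma trace_diff: "trace (\<lambda>\<mu>. f \<mu> - g \<mu>) = trace f - trace g"
  by (simp add: trace_def scaleS.scale_right_diff_distrib sum_subtractf)

lemma trace_scaleS: "trace (\<lambda>\<mu>. scaleS c (f \<mu>)) = scaleS c (trace f)"
  by (simp add: trace_def scaleS.scale_sum_right mult.commute)

lemma trace_uminus: "trace (\<lambda>\<mu>. - f \<mu>) = - trace f"
  using trace_scaleS[of "- 1" f] by simp

lemma trace_linear:
  assumes "f 0 = 0" "\<And>x y. f (x + y) = f x + f y" "\<And>c x. f (scaleS c x) = scaleS c (f x)"
  shows "f (trace g) = trace (\<lambda>\<mu>. f (g \<mu>))"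
proof -
  have "f (sum k A) = (\<Sum>a\<in>A. f (k a))" for k and A :: "4 set"
    by (induction A rule: infinite_finite_induct) (simp_all add: assms(1,2))
  then show ?thesis by (simp add: trace_def assms(3))
qed

lemma trace_sum_del: "trace (\<lambda>\<mu>. sum_del (f \<mu>) R) = sum_del (\<lambda>\<rho> S. trace (\<lambda>\<mu>. f \<mu> \<rho> S)) R"
  by (simp add: trace_def sum_del_sum sum_del_scaleS)

lemma eta_sym: "eta \<mu> \<nu> = eta \<nu> \<mu>"
  by (simp add: eta_def)

lemma trace_eta: "trace (\<lambda>\<mu>. scaleS (eta \<mu> \<rho>) (f \<mu>)) = f \<rho>"
proof -
  have "trace (\<lambda>\<mu>. scaleS (eta \<mu> \<rho>) (f \<mu>)) = (\<Sum>\<mu>\<in>UNIV. if \<mu> = \<rho> then f \<rho> else 0)"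
    unfolding trace_def by (intro sum.cong) (auto simp: eta_def)
  then show ?thesis by simp
qed

lemma trace_eta': "trace (\<lambda>\<mu>. scaleS (eta \<rho> \<mu>) (f \<mu>)) = f \<rho>"
  using trace_eta[of \<rho> f] by (simp add: eta_sym)

text \<open>The factor 4 is the dimension of spacetime: each diagonal entry of the metric has square
  1.\<close>

lemma trace_eta_diag: "trace (\<lambda>\<mu>. scaleS (eta \<mu> \<mu>) x) = scaleS 4 x"
proof -
  have "trace (\<lambda>\<mu>. scaleS (eta \<mu> \<mu>) x) = scaleS (\<Sum>\<mu>\<in>(UNIV :: 4 set). 1) x"
    unfolding trace_def scaleS.scale_sum_left by (simp add: eta_sq)
  then show ?thesis by simp
qed

section \<open>Metric factors paired with removed indices\<close>

definition eta_del :: "4 \<Rightarrow> (4 multiset \<Rightarrow> 'g::presented salg) \<Rightarrow> 4 multiset \<Rightarrow> 'g salg" where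
  "eta_del \<mu> X = sum_del (\<lambda>\<rho> S. scaleS (eta \<mu> \<rho>) (X S))"

definition eta_pairs :: "(4 multiset \<Rightarrow> 'g::presented salg) \<Rightarrow> 4 multiset \<Rightarrow> 'g salg" where
  "eta_pairs X = sum_del (\<lambda>\<rho>. eta_del \<rho> X)"

lemma eta_del_add_mset:
  "eta_del \<mu> X (add_mset a R) = scaleS (eta \<mu> a) (X R) + eta_del \<mu> (\<lambda>S. X (add_mset a S)) R"
  by (simp add: eta_del_def sum_del_add_mset)

lemma eta_pairs_empty [simp]: "eta_pairs X {#} = 0"
  by (simp add: eta_pairs_def)

text \<open>The new index is the first or the second member of an ordered pair; the metric is
  symmetric, so both cases contribute equally.\<close>

lemma eta_pairs_add_mset:
  "eta_pairs X (add_mset a R) = scaleS 2 (eta_del a X R) + eta_pairs (\<lambda>S. X (add_mset a S)) R"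
proof -
  have "scaleS 2 x = x + x" for x :: "'a salg"
    using scaleS.scale_left_distrib[of 1 1 x] by simp
  then show ?thesis
    by (simp add: eta_pairs_def sum_del_add_mset eta_del_add_mset sum_del_add)
      (simp add: eta_del_def eta_sym add_ac)
qed

lemma trace_eta_del: "trace (\<lambda>\<mu>. eta_del \<mu> (\<lambda>S. X (add_mset \<mu> S)) R) = scaleS (of_nat (size R)) (X R)"
  by (simp add: eta_del_def trace_sum_del trace_eta sum_del_const)

text \<open>The pair formed by the two contracted indices, in both orders, contributes 2 * 4.
  Pairing one of them with an entry of \<open>R\<close> contributes 4 for each entry. Pairs inside
  \<open>R\<close> leave a contracted \<open>X\<close>, which vanishes by assumption.\<close>

lemma trace_eta_pairs:
  assumes "\<And>S. trace (\<lambda>\<mu>. X (add_mset \<mu> (add_mset \<mu> S))) = 0"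
  shows "trace (\<lambda>\<mu>. eta_pairs X (add_mset \<mu> (add_mset \<mu> R))) = scaleS (4 * of_nat (size R + 2)) (X R)"
proof -
  have "trace (\<lambda>\<mu>. eta_pairs (\<lambda>S. X (add_mset \<mu> (add_mset \<mu> S))) R) = 0"
    by (simp add: eta_pairs_def eta_del_def trace_sum_del trace_scaleS assms)
  moreover have "scaleS 2 (scaleS 4 x + scaleS n x) + scaleS 2 (scaleS n x) = scaleS (4 * (n + 2)) x"
    for x :: "'a salg" and n
  proof -
    have "4 * (n + 2) = 2 * (4 + n) + 2 * n" by simp
    then show ?thesis
      by (simp only: scaleS.scale_left_distrib scaleS.scale_right_distrib scaleS.scale_scale[symmetric])
  qed
  ultimately show ?thesis
    by (simp add: eta_pairs_add_mset eta_del_add_mset trace_add trace_scaleS trace_eta_del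
        trace_eta_diag)
qed


text \<open>Serves to push \<open>dQ\<close>, \<open>retract\<close> and \<open>parity_aut\<close>
  through the metric sums.\<close>

lemma eta_del_linear:
  assumes "f 0 = 0" "\<And>x y. f (x + y) = f x + f y" "\<And>c x. f (scaleS c x) = scaleS c (f x)"
  shows "f (eta_del \<mu> X R) = eta_del \<mu> (\<lambda>S. f (X S)) R"
  by (simp add: eta_del_def sum_del_additive[of f] assms)

lemma eta_pairs_linear:
  assumes "f 0 = 0" "\<And>x y. f (x + y) = f x + f y" "\<And>c x. f (scaleS c x) = scaleS c (f x)"
  shows "f (eta_pairs X R) = eta_pairs (\<lambda>S. f (X S)) R"
  by (simp add: eta_pairs_def sum_del_additive[of f] eta_del_linear[of f] assms)

lemma eta_del_scaleS: "eta_del \<mu> (\<lambda>S. scaleS c (X S)) R = scaleS c (eta_del \<mu> X R)"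
  by (rule eta_del_linear[symmetric]) (simp_all add: scaleS.scale_right_distrib mult.commute)

lemma eta_pairs_scaleS: "eta_pairs (\<lambda>S. scaleS c (X S)) R = scaleS c (eta_pairs X R)"
  by (rule eta_pairs_linear[symmetric]) (simp_all add: scaleS.scale_right_distrib mult.commute)

lemma eta_del_zero [simp]: "eta_del \<mu> (\<lambda>S. 0) R = 0"
  and eta_pairs_zero [simp]: "eta_pairs (\<lambda>S. 0) R = 0"
  using eta_del_scaleS[of \<mu> 0 "\<lambda>_. 0"] eta_pairs_scaleS[of 0 "\<lambda>_. 0"] by simp_all

section \<open>The retraction onto the field strengths\<close>

lemma abs_salg_relator: "r \<in> relators \<Longrightarrow> abs_salg r = 0"
  by (simp add: zero_salg.abs_eq salg.abs_eq_iff rel_ideal_def ideal_gen_base)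

text \<open>Jets carry multisets of indices, symbols carry lists. By the symmetry relators the
  chosen ordering is immaterial, as \<open>Fm_mset\<close> records.\<close>

definition Fm :: "4 \<Rightarrow> 4 \<Rightarrow> 4 multiset \<Rightarrow> fsym salg" where
  "Fm \<mu> \<nu> R = genS (Fs \<mu> \<nu> (SOME \<rho>s. mset \<rho>s = R))"

lemma Fm_mset: "Fm \<mu> \<nu> (mset \<rho>s) = genS (Fs \<mu> \<nu> \<rho>s)"
proof -
  have "gen (Fs \<mu> \<nu> (SOME \<rho>s'. mset \<rho>s' = mset \<rho>s)) - gen (Fs \<mu> \<nu> \<rho>s) \<in> relators"
    using someI[of "\<lambda>\<rho>s'. mset \<rho>s' = mset \<rho>s" \<rho>s] unfolding relators_fsym_def by blast
  then show ?thesis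
    by (simp add: Fm_def genS.abs_eq salg.abs_eq_iff rel_ideal_def ideal_gen_base)
qed

lemma Fm_antisym: "Fm \<mu> \<nu> R = - Fm \<nu> \<mu> R"
proof -
  obtain \<rho>s where R: "R = mset \<rho>s" using ex_mset by metis
  have "gen (Fs \<mu> \<nu> \<rho>s) + gen (Fs \<nu> \<mu> \<rho>s) \<in> relators"
    unfolding relators_fsym_def by blast
  from abs_salg_relator[OF this] show ?thesis
    by (simp add: R Fm_mset abs_salg_simps eq_neg_iff_add_eq_0)
qed

lemma Fm_trace1: "trace (\<lambda>\<mu>. Fm \<mu> \<nu> (add_mset \<mu> R)) = 0"
proof -
  obtain \<rho>s where R: "R = mset \<rho>s" using ex_mset by metis
  have "(\<Sum>\<mu>\<in>UNIV. \<Sum>\<rho>\<in>UNIV. cst (eta \<mu> \<rho>) * gen (Fs \<mu> \<nu> (\<rho> # \<rho>s))) \<in> relators"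
    unfolding relators_fsym_def by blast
  from abs_salg_relator[OF this] show ?thesis
    by (simp add: R Fm_mset[of _ _ "_ # _", simplified] abs_salg_simps abs_salg_sum trace_eq)
qed

lemma Fm_trace2: "trace (\<lambda>\<rho>. Fm \<mu> \<nu> (add_mset \<rho> (add_mset \<rho> R))) = 0"
proof -
  obtain \<rho>s where R: "R = mset \<rho>s" using ex_mset by metis
  have "(\<Sum>\<rho>\<in>UNIV. \<Sum>\<sigma>\<in>UNIV. cst (eta \<rho> \<sigma>) * gen (Fs \<mu> \<nu> (\<rho> # \<sigma> # \<rho>s))) \<in> relators"
    unfolding relators_fsym_def by blast
  from abs_salg_relator[OF this] show ?thesis
    by (simp add: R Fm_mset[of _ _ "_ # _ # _", simplified] abs_salg_simps abs_salg_sum trace_eq)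
qed

text \<open>Stands in for having parity \<open>a\<close>: it is the property that values prescribed
  on generators must have for the induced map to respect graded commutativity.\<close>

definition graded :: "bool \<Rightarrow> 'g::presented salg \<Rightarrow> bool" where
  "graded a x \<longleftrightarrow> (\<forall>h. x * genS h = scaleS (if a \<and> odd_gen h then -1 else 1) (genS h * x))"

lemma graded_zero: "graded a 0"
  by (simp add: graded_def)

lemma graded_add: "graded a x \<Longrightarrow> graded a y \<Longrightarrow> graded a (x + y)"
  by (simp only: graded_def distrib_left distrib_right scaleS.scale_right_distrib)
    simp

lemma graded_scaleS: "graded a x \<Longrightarrow> graded a (scaleS c x)"
  by (simp add: graded_def scaleS_mult_left scaleS_mult_right mult.commute)

lemma graded_uminus: "graded a x \<Longrightarrow> graded a (- x)"
  using graded_scaleS[of a x "- 1"] by simp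

lemma graded_diff: "graded a x \<Longrightarrow> graded a y \<Longrightarrow> graded a (x - y)"
  using graded_add[of a x "scaleS (- 1) y"] graded_scaleS[of a y "- 1"] by simp

lemma graded_genS: "odd_gen g = a \<Longrightarrow> graded a (genS g)"
  unfolding graded_def by (subst genS_graded_comm) auto

lemma graded_sum: "(\<And>i. i \<in> A \<Longrightarrow> graded a (f i)) \<Longrightarrow> graded a (sum f A)"
  by (induction A rule: infinite_finite_induct) (auto intro: graded_zero graded_add)

lemma graded_sum_del: "(\<And>\<rho> S. graded a (f \<rho> S)) \<Longrightarrow> graded a (sum_del f R)"
  by (induction R arbitrary: f) (simp_all add: graded_zero sum_del_add_mset graded_add)

lemma graded_Fm: "graded False (Fm \<mu> \<nu> R)"
  by (simp add: Fm_def graded_genS odd_gen_fsym_def)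

lemma graded_False_commute: "graded False x \<Longrightarrow> x * y = y * x"
proof (induction y rule: salg_induct)
  case (gen g y)
  have "x * (genS g * y) = genS g * (x * y)"
    using gen.prems by (simp add: graded_def flip: mult.assoc)
  then show ?case using gen by (simp add: mult.assoc)
qed (simp_all add: distrib_left distrib_right scaleS_mult_left scaleS_mult_right)

text \<open>The factor $1/(n+1)$ is fixed by the requirement that $F_{\mu\nu;\rho_1,\dots,\rho_n}$ be mapped to itself
  modulo the Bianchi identities.\<close>

fun rval :: "jet \<Rightarrow> fsym salg" where
  "rval (Vj \<mu> R) = scaleS (1 / of_nat (size R + 1)) (sum_del (\<lambda>\<rho> S. Fm \<rho> \<mu> S) R)"
| "rval (Uj R) = (if R = {#} then genS Us else 0)"
| "rval (Tj R) = 0"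

lemma graded_rval_Vj: "graded False (rval (Vj \<mu> R))"
  by (simp add: graded_scaleS graded_sum_del graded_Fm)

lemma rval_graded_comm:
  "rval g * rval h = scaleS (if odd_gen g \<and> odd_gen h then -1 else 1) (rval h * rval g)"
proof (cases g)
  case (Vj \<mu> R)
  then show ?thesis
    using graded_False_commute[OF graded_rval_Vj[of \<mu> R], of "rval h"] by (simp del: rval.simps)
next
  case (Uj R)
  show ?thesis
  proof (cases h)
    case (Vj \<mu> S)
    then show ?thesis
      using graded_False_commute[OF graded_rval_Vj[of \<mu> S], of "rval g"] by (simp del: rval.simps)
  next
    case (Uj S)
    have "genS Us * genS Us = scaleS (-1) (genS Us * genS Us)"
      by (subst genS_graded_comm) (simp add: odd_gen_fsym_def)
    with Uj \<open>g = Uj R\<close> show ?thesis by simp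
  qed simp
qed simp

text \<open>If one of the two contracted indices is removed, it becomes an antisymmetric index
  contracted with a derivative index (\<open>Fm_trace1\<close>). Otherwise two derivative indices
  stay contracted (\<open>Fm_trace2\<close>).\<close>

lemma rval_box_Vj: "trace (\<lambda>\<sigma>. rval (Vj \<mu> (add_mset \<sigma> (add_mset \<sigma> R)))) = 0"
  by (simp add: trace_scaleS sum_del_add_mset trace_add trace_sum_del Fm_trace1 Fm_trace2 del: of_nat_Suc)

lift_definition retract :: "onshell \<Rightarrow> fsym salg" is "free_subst rval"
proof -
  fix p q :: "jet free"
  assume "p - q \<in> rel_ideal"
  then have "free_subst rval (p - q) = 0"
  proof (rule free_subst_ideal[OF rval_graded_comm, rotated])
    have "free_subst rval (box j R) = trace (\<lambda>\<sigma>. rval (j (add_mset \<sigma> (add_mset \<sigma> R))))" for j R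
      by (simp add: box_def free_subst_simps free_subst_gen trace_eq)
    \<comment> \<open>The equations of motion of u and its antighost are trivial here:
      \<open>rval\<close> vanishes on proper derivatives of u and on every
      \<open>Tj\<close>.\<close>
    then show "free_subst rval r = 0" if "r \<in> relators" for r
      using that by (auto simp: relators_jet_def rval_box_Vj simp del: rval.simps(1))
  qed
  then show "free_subst rval p = free_subst rval q"
    by (simp add: free_subst_simps)
qed

lemma retract_simps:
  "retract 0 = 0" "retract (x + y) = retract x + retract y" "retract (x - y) = retract x - retract y"
  "retract (- x) = - retract x"
  "retract (scaleS c x) = scaleS c (retract x)" "retract (x * y) = retract x * retract y"
  by (transfer; simp add: free_subst_simps free_subst_mult free_subst_cst scaleS_mult_left)+

lemma retract_one: "retract 1 = 1"
  by transfer (use free_subst_cst[of rval 1] in simp)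

lemma retract_genS: "retract (genS j) = rval j"
  by transfer (simp add: free_subst_gen)

lemma subst_sym_simps:
  "subst_sym 0 = 0" "subst_sym (x + y) = subst_sym x + subst_sym y"
  "subst_sym (x - y) = subst_sym x - subst_sym y"
  "subst_sym (scaleS c x) = scaleS c (subst_sym x)" "subst_sym (x * y) = subst_sym x * subst_sym y"
  by (transfer; simp add: free_subst_simps free_subst_mult free_subst_cst scaleS_mult_left)+

lemma subst_sym_one: "subst_sym 1 = 1"
  by transfer (use free_subst_cst[of sym_val 1] in simp)

lemma subst_sym_genS: "subst_sym (genS j) = sym_val j"
  by transfer (simp add: free_subst_gen)

text \<open>Removing the contracted index yields \<open>Fm\<close> with two equal antisymmetric
  indices; removing another one yields a trace between an antisymmetric and a derivative index. Both
  vanish.\<close>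

lemma retract_Bj: "retract (Bj R) = 0"
proof -
  have "trace (\<lambda>\<mu>. Fm \<mu> \<mu> R) = 0"
  proof -
    have "Fm \<mu> \<mu> R = 0" for \<mu>
    proof -
      have "scaleS 2 (Fm \<mu> \<mu> R) = 0"
        using scaleS.scale_left_distrib[of 1 1 "Fm \<mu> \<mu> R"] Fm_antisym[of \<mu> \<mu> R]
        by (simp add: eq_neg_iff_add_eq_0)
      then show ?thesis by (simp only: scaleS.scale_eq_0_iff) simp
    qed
    then show ?thesis by simp
  qed
  moreover have "trace (\<lambda>\<mu>. Fm \<rho> \<mu> (add_mset \<mu> S)) = 0" for \<rho> S
    using trace_scaleS[of "- 1" "\<lambda>\<mu>. Fm \<mu> \<rho> (add_mset \<mu> S)"]
    by (subst Fm_antisym) (simp add: Fm_trace1)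
  ultimately show ?thesis
    by (simp add: Bj_def trace_eq trace_linear[of retract] retract_simps retract_genS
        trace_scaleS sum_del_add_mset trace_add
        trace_sum_del)
qed

text \<open>On generators \<open>dQ\<close> produces proper derivatives of u or derivatives of B,
  all of which \<open>retract\<close> kills. Multiplicativity of \<open>retract\<close> carries this
  to products.\<close>

lemma retract_dQ: "retract (dQ x) = 0"
proof (induction x rule: salg_induct)
  case (gen g x)
  have "retract (dQ (genS g)) = 0"
    by (cases g) (simp_all add: genS_brs dQ_genS_Tj retract_simps retract_genS retract_Bj)
  with gen show ?case by (simp add: dQ_mult retract_simps)
qed (simp_all add: dQ_simps dQ_one retract_simps)


section \<open>The two composites of substitution and retraction\<close>

lemma subst_sym_Fm:
  "subst_sym (Fm \<mu> \<nu> M) = genS (Vj \<nu> (add_mset \<mu> M)) - genS (Vj \<mu> (add_mset \<nu> M))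
    + scaleS (1 / of_nat (size M + 2))
        (eta_del \<mu> (\<lambda>S. Bj (add_mset \<nu> S)) M - eta_del \<nu> (\<lambda>S. Bj (add_mset \<mu> S)) M)"
proof -
  obtain \<rho>s where M: "M = mset \<rho>s" using ex_mset by metis
  show ?thesis
    unfolding M Fm_mset subst_sym_genS sym_val.simps F0_eq eta_del_def
    by (simp only: sum_del_diff[symmetric]) (simp only: sum_del_def)
qed

text \<open>The three terms of a Bianchi identity have equally many derivative indices, hence the
  same prefactor in front of their B-corrections; the v-parts and the B-parts then cancel
  cyclically.\<close>

lemma subst_sym_bianchi_ideal: "x \<in> bianchi_ideal \<Longrightarrow> subst_sym x = 0"
  unfolding bianchi_ideal_def
proof (induction rule: ideal_gen.induct)
  case (mult r a b)
  then obtain \<mu> \<nu> \<rho> \<sigma>s where r: "r = genS (Fs \<mu> \<nu> (\<rho> # \<sigma>s)) + genS (Fs \<nu> \<rho> (\<mu> # \<sigma>s))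
     + genS (Fs \<rho> \<mu> (\<nu> # \<sigma>s))" by blast
  have "subst_sym r = 0"
    unfolding r Fm_mset[symmetric] mset.simps subst_sym_simps subst_sym_Fm size_add_mset eta_del_add_mset
    by (simp only: add_mset_commute eta_sym scaleS.scale_right_distrib scaleS.scale_right_diff_distrib)
      (simp add: algebra_simps)
  then show ?case by (simp add: subst_sym_simps)
qed (simp_all add: subst_sym_simps)

lemma bianchi_Fm:
  "Fm \<mu> \<nu> (add_mset \<rho> S) + Fm \<nu> \<rho> (add_mset \<mu> S) + Fm \<rho> \<mu> (add_mset \<nu> S) \<in> bianchi_ideal"
proof -
  obtain \<sigma>s where S: "S = mset \<sigma>s" using ex_mset by metis
  show ?thesis
    unfolding S mset.simps[symmetric] Fm_mset bianchi_ideal_def by (rule ideal_gen_base) blast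
qed

lemma ideal_gen_sum_del: "(\<And>\<rho> S. f \<rho> S \<in> ideal_gen I) \<Longrightarrow> sum_del f R \<in> ideal_gen I"
  by (induction R arbitrary: f) (simp_all add: sum_del_add_mset ideal_gen.zero ideal_gen.add)

text \<open>The B-corrections are killed. With n the size of \<open>M\<close>, the rest is 1/(n+2)
  times 2 \<open>Fm \<mu> \<nu> M\<close> plus n pairs of terms, each of which the Bianchi identity
  turns into one more \<open>Fm \<mu> \<nu> M\<close>; the error is collected in
  \<open>W\<close>.\<close>

lemma retract_F0: "retract (F0 \<mu> \<nu> \<rho>s) - genS (Fs \<mu> \<nu> \<rho>s) \<in> bianchi_ideal"
proof -
  define M where "M = mset \<rho>s"
  define N :: complex where "N = of_nat (size M + 2)"
  define W where
    "W = sum_del (\<lambda>\<rho> S. Fm \<mu> \<nu> (add_mset \<rho> S) + Fm \<nu> \<rho> (add_mset \<mu> S) + Fm \<rho> \<mu> (add_mset \<nu> S)) M"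
  have N: "N \<noteq> 0" unfolding N_def by (simp only: of_nat_eq_0_iff)
  have "W \<in> bianchi_ideal"
    using bianchi_Fm unfolding W_def bianchi_ideal_def by (intro ideal_gen_sum_del)
  then have "scaleS (- 1 / N) W \<in> bianchi_ideal"
    unfolding bianchi_ideal_def by (rule ideal_gen_scaleS)
  moreover have "retract (F0 \<mu> \<nu> \<rho>s) - Fm \<mu> \<nu> M = scaleS (- 1 / N) W"
  proof -
    have "F0 \<mu> \<nu> \<rho>s = subst_sym (Fm \<mu> \<nu> M)"
      by (simp add: M_def Fm_mset subst_sym_genS)
    then have "retract (F0 \<mu> \<nu> \<rho>s) = rval (Vj \<nu> (add_mset \<mu> M)) - rval (Vj \<mu> (add_mset \<nu> M))"
      by (simp add: subst_sym_Fm retract_simps retract_genS eta_del_linear[of retract] retract_Bj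
          del: rval.simps)
    also have "\<dots> = scaleS (1 / N) (Fm \<mu> \<nu> M + sum_del (\<lambda>\<rho> S. Fm \<rho> \<nu> (add_mset \<mu> S)) M
        - (Fm \<nu> \<mu> M + sum_del (\<lambda>\<rho> S. Fm \<rho> \<mu> (add_mset \<nu> S)) M))"
      by (simp add: N_def sum_del_add_mset scaleS.scale_right_diff_distrib)
    also have "Fm \<mu> \<nu> M + sum_del (\<lambda>\<rho> S. Fm \<rho> \<nu> (add_mset \<mu> S)) M
        - (Fm \<nu> \<mu> M + sum_del (\<lambda>\<rho> S. Fm \<rho> \<mu> (add_mset \<nu> S)) M) = scaleS N (Fm \<mu> \<nu> M) - W"
    proof -
      have "sum_del (\<lambda>\<rho> S. Fm \<rho> \<nu> (add_mset \<mu> S)) M = - sum_del (\<lambda>\<rho> S. Fm \<nu> \<rho> (add_mset \<mu> S)) M"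
        by (simp only: sum_del_uminus[symmetric] Fm_antisym[symmetric])
      moreover have "scaleS N x = x + x + scaleS (of_nat (size M)) x" for x :: "fsym salg"
      proof -
        have "N = 1 + 1 + of_nat (size M)" by (simp add: N_def)
        then show ?thesis by (simp only: scaleS.scale_left_distrib scaleS.scale_one)
      qed
      ultimately show ?thesis
        using Fm_antisym[of \<nu> \<mu> M] by (simp add: W_def sum_del_add sum_del_const)
    qed
    finally show ?thesis
      using N by (simp add: scaleS.scale_right_diff_distrib)
  qed
  ultimately show ?thesis by (simp add: M_def Fm_mset)
qed

lemma retract_subst_sym: "retract (subst_sym x) - x \<in> bianchi_ideal"
proof (induction x rule: salg_induct)
  case (gen g x)
  have "retract (sym_val g) - genS g \<in> bianchi_ideal"
  proof (cases g)
    case Us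
    then show ?thesis
      by (simp add: field_u_def retract_genS bianchi_ideal_def ideal_gen.zero)
  next
    case (Fs \<mu> \<nu> \<rho>s)
    then show ?thesis by (simp add: retract_F0)
  qed
  \<comment> \<open>Congruences modulo a two-sided ideal multiply: ab - a'b' = (a - a')b + a'(b -
    b').\<close>
  with gen have "(retract (sym_val g) - genS g) * retract (subst_sym x)
      + genS g * (retract (subst_sym x) - x)
      \<in> bianchi_ideal"
    unfolding bianchi_ideal_def by (intro ideal_gen.add ideal_gen_lmult ideal_gen_rmult)
  then show ?case
    by (simp add: subst_sym_simps subst_sym_genS retract_simps algebra_simps)
next
  case (add x y)
  then have "(retract (subst_sym x) - x) + (retract (subst_sym y) - y) \<in> bianchi_ideal"
    unfolding bianchi_ideal_def by (rule ideal_gen.add)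
  then show ?case by (simp add: subst_sym_simps retract_simps algebra_simps)
qed (simp_all add: subst_sym_simps subst_sym_one retract_simps retract_one bianchi_ideal_def ideal_gen.zero)

lemma subst_sym_retract_subst_sym: "subst_sym (retract (subst_sym x)) = subst_sym x"
  using subst_sym_bianchi_ideal[OF retract_subst_sym[of x]] by (simp add: subst_sym_simps)

section \<open>The contracting homotopy\<close>

lemma trace_box: "j \<in> range Vj \<union> {Uj, Tj} \<Longrightarrow> trace (\<lambda>\<mu>. genS (j (add_mset \<mu> (add_mset \<mu> R)))) = 0"
  using box_genS[of j R] by (simp add: trace_eq)

lemma trace_box_Bj: "trace (\<lambda>\<mu>. Bj (add_mset \<mu> (add_mset \<mu> R))) = 0"
  using box_Bj[of R] by (simp add: trace_def)

lemma Bj_trace: "Bj R = trace (\<lambda>\<mu>. genS (Vj \<mu> (add_mset \<mu> R)))"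
  by (simp add: Bj_def trace_eq)

lemma trace_eta_del_twice:
  assumes "\<And>S. trace (\<lambda>\<mu>. X (add_mset \<mu> (add_mset \<mu> S))) = 0"
  shows "trace (\<lambda>\<sigma>. eta_del \<mu> X (add_mset \<sigma> (add_mset \<sigma> R))) = scaleS 2 (X (add_mset \<mu> R))"
proof -
  have "trace (\<lambda>\<sigma>. eta_del \<mu> (\<lambda>S. X (add_mset \<sigma> (add_mset \<sigma> S))) R) = 0"
    by (simp add: eta_del_def trace_sum_del trace_scaleS assms)
  then show ?thesis
    using scaleS.scale_left_distrib[of 1 1 "X (add_mset \<mu> R)"]
    by (simp add: eta_del_add_mset trace_add trace_eta')
qed

text \<open>The trace parts are forced by the equations of motion (\<open>trace_hval_Vj\<close>, \<open>trace_hval_Uj\<close>), the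
  overall factors by $h B_R = i \tilde u_R$ and $d_Q h u_R = u_R$. Each unordered pair of indices occurs
  twice in \<open>eta_pairs\<close>, whence the factors $1/2$. For empty \<open>R\<close> the divisions by \<open>size R = 0\<close> are
  harmless because the sums are empty.\<close>

fun hval :: "jet \<Rightarrow> onshell" where
  "hval (Vj \<mu> R) = scaleS (\<i> / of_nat (size R + 1) ^ 2)
     (scaleS (of_nat (size R)) (eta_del \<mu> (\<lambda>S. genS (Tj S)) R)
      - scaleS (1 / 2) (eta_pairs (\<lambda>S. genS (Tj (add_mset \<mu> S))) R))"
| "hval (Uj R) = scaleS (- \<i>)
     (scaleS (1 / of_nat (size R)) (sum_del (\<lambda>\<rho> S. genS (Vj \<rho> S)) R)
      - scaleS (1 / (2 * of_nat (size R) ^ 2)) (eta_pairs Bj R))"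
| "hval (Tj R) = 0"

text \<open>With N = \<open>size R + 2\<close>, the \<open>eta_del\<close> term and the halved
  \<open>eta_pairs\<close> term both trace to 2N times \<open>Tj (add_mset \<mu> R)\<close>, so they
  cancel.\<close>

lemma trace_hval_Vj: "trace (\<lambda>\<sigma>. hval (Vj \<mu> (add_mset \<sigma> (add_mset \<sigma> R)))) = 0"
proof -
  have "trace (\<lambda>\<sigma>. genS (Tj (add_mset \<sigma> (add_mset \<sigma> S)))) = 0" for S
    using trace_box[of Tj] by simp
  then have "trace (\<lambda>\<sigma>. eta_del \<mu> (\<lambda>S. genS (Tj S)) (add_mset \<sigma> (add_mset \<sigma> R)))
      = scaleS 2 (genS (Tj (add_mset \<mu> R)))"
    "trace (\<lambda>\<sigma>. eta_pairs (\<lambda>S. genS (Tj (add_mset \<mu> S))) (add_mset \<sigma> (add_mset \<sigma> R)))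
      = scaleS (4 * of_nat (size R + 2)) (genS (Tj (add_mset \<mu> R)))"
    by (subst trace_eta_del_twice trace_eta_pairs; simp add: add_mset_commute[of \<mu>])+
  then show ?thesis
    by (simp add: trace_scaleS trace_diff)
qed

text \<open>Both terms trace to (2/N) \<open>Bj R\<close>, where N =
  \<open>size R + 2\<close>.\<close>

lemma trace_hval_Uj: "trace (\<lambda>\<sigma>. hval (Uj (add_mset \<sigma> (add_mset \<sigma> R)))) = 0"
proof -
  define N :: complex where "N = of_nat (size R + 2)"
  have N: "N \<noteq> 0" unfolding N_def by (simp only: of_nat_eq_0_iff)
  have V: "trace (\<lambda>\<sigma>. sum_del (\<lambda>\<rho> S. genS (Vj \<rho> S)) (add_mset \<sigma> (add_mset \<sigma> R))) = scaleS 2 (Bj R)"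
    using scaleS.scale_left_distrib[of 1 1 "Bj R"] trace_box
    by (simp add: sum_del_add_mset trace_add trace_sum_del Bj_trace)
  have "trace (\<lambda>\<sigma>. hval (Uj (add_mset \<sigma> (add_mset \<sigma> R)))) =
      scaleS (- \<i>) (scaleS (1 / N) (scaleS 2 (Bj R)) - scaleS (1 / (2 * N ^ 2)) (scaleS (4 * N) (Bj R)))"
    unfolding V[symmetric] N_def trace_eta_pairs[OF trace_box_Bj, symmetric]
    by (simp add: trace_scaleS trace_diff trace_uminus)
  also have "\<dots> = 0"
    using N by (simp add: power2_eq_square)
  finally show ?thesis .
qed

section \<open>The homotopy as an odd derivation\<close>

lemma abs_rep_salg: "abs_salg (rep_salg x) = x"
  by (rule Quotient_abs_rep[OF Quotient_salg])

lemma free_graded_rep: "graded a x \<Longrightarrow> free_graded a (rep_salg x)"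
proof -
  assume "graded a x"
  moreover have "abs_salg (p * q) = abs_salg p * abs_salg q" for p q :: "'a free"
    by (simp add: times_salg.abs_eq)
  ultimately have "abs_salg (rep_salg x * gen h) =
      abs_salg (cst (if a \<and> odd_gen h then -1 else 1) * (gen h * rep_salg x))" for h
    unfolding abs_salg_simps(3) by (simp only: abs_salg_simps(4) abs_rep_salg graded_def)
  then show ?thesis by (simp only: free_graded_def salg.abs_eq_iff) blast
qed

lemma graded_hval: "graded (odd_gen g \<noteq> True) (hval g)"
  by (cases g) (auto simp: eta_pairs_def eta_del_def Bj_def
      intro!: graded_zero graded_scaleS graded_uminus graded_diff graded_sum_del graded_sum graded_genS)

text \<open>\<open>free_der\<close> expects values in the free algebra, whereas \<open>hval\<close>
  takes them in the quotient. The choice made by \<open>rep_salg\<close> disappears again in the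
  quotient, see \<open>hQ_genS\<close>.\<close>

lift_definition hQ :: "onshell \<Rightarrow> onshell" is "free_der True (\<lambda>j. rep_salg (hval j))"
proof -
  fix p q :: "jet free"
  let ?h = "free_der True (\<lambda>j. rep_salg (hval j))"
  assume "p - q \<in> rel_ideal"
  then have "?h (p - q) \<in> rel_ideal"
  proof (rule free_der_ideal[rotated -1])
    have "abs_salg (?h (box j R)) = trace (\<lambda>\<sigma>. hval (j (add_mset \<sigma> (add_mset \<sigma> R))))" for j R
      by (simp add: box_def free_der_simps free_der_gen abs_salg_simps abs_salg_sum abs_rep_salg trace_eq)
    then have "abs_salg (?h r) = 0" if "r \<in> relators" for r
      using that by (auto simp: relators_jet_def trace_hval_Vj trace_hval_Uj simp del: hval.simps(1,2))
    then show "?h r \<in> rel_ideal" if "r \<in> relators" for r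
      using that by (simp add: zero_salg.abs_eq salg.abs_eq_iff)
    show "?h (gen g * gen h - cst (if odd_gen g \<and> odd_gen h then -1 else 1) * (gen h * gen g))
        \<in> rel_ideal" for g h
      by (rule free_der_graded_comm) (rule free_graded_rep, rule graded_hval)
  qed (rule free_twist_relators_jet)
  then show "?h p - ?h q \<in> rel_ideal"
    by (simp add: free_der_simps)
qed

lemma hQ_simps:
  "hQ 0 = 0" "hQ (x + y) = hQ x + hQ y" "hQ (x - y) = hQ x - hQ y" "hQ (- x) = - hQ x"
  "hQ (scaleS c x) = scaleS c (hQ x)"
  by (transfer; simp add: free_der_simps rel_ideal_def ideal_gen.zero)+

lemma hQ_mult: "hQ (x * y) = hQ x * y + parity_aut x * hQ y"
  by transfer (simp add: free_der_mult rel_ideal_def ideal_gen.zero)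

lemma hQ_one: "hQ 1 = 0"
  by transfer
    (use free_der_cst[of True "\<lambda>j. rep_salg (hval j)" 1] in \<open>simp add: rel_ideal_def ideal_gen.zero\<close>)

lemma hQ_genS: "hQ (genS j) = hval j"
  by (simp add: genS_def hQ.abs_eq free_der_gen abs_rep_salg)


text \<open>With n = \<open>size R\<close>, the two parts of \<open>hval\<close> contract to
  (n+1)(n+4) and -n times \<open>Tj R\<close>. Their sum (n+2)^2 is exactly the squared denominator
  in \<open>hval\<close>.\<close>

lemma hQ_Bj: "hQ (Bj R) = scaleS \<i> (genS (Tj R))"
proof -
  define n :: complex where "n = of_nat (size R)"
  define T :: onshell where "T = genS (Tj R)"
  have N: "n + 2 \<noteq> 0"
    using of_nat_eq_0_iff[of "size R + 2", where ?'a = complex] by (simp add: n_def add.commute)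
  have del: "trace (\<lambda>\<mu>. eta_del \<mu> (\<lambda>S. genS (Tj S)) (add_mset \<mu> R)) = scaleS (n + 4) T"
    by (simp add: eta_del_add_mset trace_add trace_eta_diag
        trace_eta_del[of "\<lambda>S. genS (Tj S)"] n_def T_def scaleS.scale_left_distrib add.commute)
  have "trace (\<lambda>\<mu>. genS (Tj (add_mset \<mu> (add_mset \<mu> S)))) = 0" for S
    using trace_box[of Tj] by simp
  then have "trace (\<lambda>\<mu>. eta_pairs (\<lambda>S. genS (Tj (add_mset \<mu> (add_mset \<mu> S)))) R) = 0"
    by (simp add: eta_pairs_def eta_del_def trace_sum_del trace_scaleS)
  then have pairs: "trace (\<lambda>\<mu>. eta_pairs (\<lambda>S. genS (Tj (add_mset \<mu> S))) (add_mset \<mu> R)) = scaleS (2 * n) T"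
    by (simp add: eta_pairs_add_mset trace_add trace_scaleS
        trace_eta_del[of "\<lambda>S. genS (Tj S)"] n_def T_def)
  have "hQ (Bj R) = trace (\<lambda>\<mu>. hval (Vj \<mu> (add_mset \<mu> R)))"
    by (simp add: Bj_trace trace_linear[of hQ] hQ_simps hQ_genS del: hval.simps)
  also have "\<dots> = scaleS (\<i> / (n + 2) ^ 2)
      (scaleS (n + 1) (scaleS (n + 4) T) - scaleS (1 / 2) (scaleS (2 * n) T))"
    unfolding del[symmetric] pairs[symmetric]
    by (simp add: trace_scaleS trace_diff n_def add.commute)
  also have "scaleS (n + 1) (scaleS (n + 4) T) - scaleS (1 / 2) (scaleS (2 * n) T)
      = scaleS ((n + 1) * (n + 4) - n) T"
    by (simp add: scaleS.scale_left_diff_distrib)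
  also have "(n + 1) * (n + 4) - n = (n + 2) ^ 2"
    by (simp add: power2_eq_square algebra_simps)
  also have "scaleS (\<i> / (n + 2) ^ 2) (scaleS ((n + 2) ^ 2) T) = scaleS \<i> T"
    using N by simp
  finally show ?thesis by (simp add: T_def)
qed

section \<open>The homotopy Laplacian\<close>

definition lap :: "onshell \<Rightarrow> onshell" where "lap x = dQ (hQ x) + hQ (dQ x)"

lemma lap_simps:
  "lap 0 = 0" "lap (x + y) = lap x + lap y" "lap (x - y) = lap x - lap y"
  "lap (scaleS c x) = scaleS c (lap x)"
  by (simp_all add: lap_def hQ_simps dQ_simps scaleS.scale_right_distrib algebra_simps)

lemma lap_one: "lap 1 = 0"
  by (simp add: lap_def hQ_one dQ_one hQ_simps dQ_simps)

lemma parity_aut_diff: "parity_aut (x - y) = parity_aut x - parity_aut y"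
  using parity_aut_simps(3)[of x "- y"] by (simp add: parity_aut_simps(2))

lemma parity_aut_hval: "parity_aut (hval g) = - hQ (parity_aut (genS g))"
  by (cases g) (simp_all add: parity_aut_genS hQ_simps hQ_genS parity_aut_simps parity_aut_diff parity_aut_Bj
      sum_del_additive[of parity_aut] eta_del_linear[of parity_aut] eta_pairs_linear[of parity_aut]
      sum_del_uminus eta_del_scaleS[of _ "- 1", simplified] eta_pairs_scaleS[of "- 1", simplified]
      scaleS.scale_right_diff_distrib)

lemma parity_aut_dQ_genS: "parity_aut (dQ (genS g)) = - dQ (parity_aut (genS g))"
  by (cases g) (simp_all add: genS_brs dQ_simps dQ_genS_Tj parity_aut_genS parity_aut_simps parity_aut_Bj)

text \<open>The anticommutator of two odd derivations is an even derivation: the mixed terms cancel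
  because both maps anticommute with \<open>parity_aut\<close> on generators.\<close>

lemma lap_genS_mult: "lap (genS g * x) = lap (genS g) * x + genS g * lap x"
proof -
  have "parity_aut (parity_aut (genS g)) = genS g"
    by (simp add: parity_aut_genS parity_aut_simps)
  then show ?thesis
    by (simp add: lap_def hQ_mult dQ_mult hQ_simps dQ_simps hQ_genS parity_aut_hval
        parity_aut_dQ_genS algebra_simps)
qed

lemma lap_mult: "lap (x * y) = lap x * y + x * lap y"
proof (induction x rule: salg_induct)
  case (gen g x)
  then show ?case by (simp add: mult.assoc lap_genS_mult algebra_simps)
qed (simp_all add: lap_simps lap_one scaleS_mult_left algebra_simps)

text \<open>Both sides are explicit linear combinations of $v_{\mu;R}$, $v_{\rho;\mu R\setminus\rho}$,
  $\eta_{\mu\rho} B_{R\setminus\rho}$ and $\eta_{\rho\sigma} B_{\mu R\setminus\rho\sigma}$; the coefficients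
  in \<open>hval\<close> are chosen so that they agree.\<close>

lemma lap_genS_Vj: "lap (genS (Vj \<mu> R)) = genS (Vj \<mu> R) - subst_sym (rval (Vj \<mu> R))"
proof -
  define N :: complex where "N = of_nat (size R + 1)"
  have N: "N \<noteq> 0" unfolding N_def by (simp only: of_nat_eq_0_iff)
  have n: "of_nat (size R) = N - 1" by (simp add: N_def)
  define a :: onshell where "a = genS (Vj \<mu> R)"
  define b :: onshell where "b = sum_del (\<lambda>\<rho> S. genS (Vj \<rho> (add_mset \<mu> S))) R"
  define c where "c = eta_del \<mu> Bj R"
  define p where "p = eta_pairs (\<lambda>S. Bj (add_mset \<mu> S)) R"
  have dh: "dQ (hQ a) = scaleS (1 / N ^ 2) (scaleS (N - 1) c - scaleS (1 / 2) p)"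
    by (simp add: a_def hQ_genS dQ_simps eta_del_linear[of dQ] eta_pairs_linear[of dQ] dQ_genS_Tj
        eta_del_scaleS[of _ "- \<i>", simplified] eta_pairs_scaleS[of "- \<i>", simplified]
        scaleS.scale_right_distrib scaleS.scale_right_diff_distrib c_def p_def N_def mult.commute)
  have hd: "hQ (dQ a) = scaleS (1 / N) (a + b) - scaleS (1 / (2 * N ^ 2)) (scaleS 2 c + p)"
    by (simp add: a_def genS_brs hQ_simps hQ_genS sum_del_add_mset eta_pairs_add_mset b_def c_def p_def N_def)
  \<comment> \<open>After exchanging the order of removal, the inner sum puts its removed index back
    and so counts the \<open>size R - 1\<close>, that is \<open>N - 2\<close>, remaining
    entries.\<close>
  have "sum_del (\<lambda>\<rho> S. eta_del \<mu> (\<lambda>T. Bj (add_mset \<rho> T)) S) R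
      = sum_del (\<lambda>\<sigma> S. scaleS (N - 2) (scaleS (eta \<mu> \<sigma>) (Bj S))) R"
    unfolding eta_del_def
    by (subst sum_del_swap)
      (auto intro!: sum_del_cong simp: sum_del_scaleS sum_del_const N_def mult.commute)
  then have c': "sum_del (\<lambda>\<rho> S. eta_del \<mu> (\<lambda>T. Bj (add_mset \<rho> T)) S) R = scaleS (N - 2) c"
    by (simp only: sum_del_scaleS c_def eta_del_def)
  have "subst_sym (sum_del (\<lambda>\<rho> S. Fm \<rho> \<mu> S) R) = sum_del (\<lambda>\<rho> S.
      a - genS (Vj \<rho> (add_mset \<mu> S))
      + scaleS (1 / N) (eta_del \<rho> (\<lambda>S. Bj (add_mset \<mu> S)) S - eta_del \<mu> (\<lambda>S. Bj (add_mset \<rho> S)) S)) R"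
    by (auto intro!: sum_del_cong simp: sum_del_additive[of subst_sym] subst_sym_simps
        subst_sym_Fm a_def N_def add.commute)
  also have "\<dots> = scaleS (N - 1) a - b + scaleS (1 / N) (p - scaleS (N - 2) c)"
    unfolding c'[symmetric] n[symmetric]
    using sum_del_const[of "\<lambda>_. a" R]
    by (simp add: sum_del_add sum_del_diff sum_del_scaleS b_def p_def eta_pairs_def)
  finally have \<pi>: "subst_sym (rval (Vj \<mu> R))
      = scaleS (1 / N) (scaleS (N - 1) a - b + scaleS (1 / N) (p - scaleS (N - 2) c))"
    by (simp add: subst_sym_simps N_def)
  \<comment> \<open>Comparison of the coefficients of \<open>a\<close>, \<open>c\<close> and
    \<open>p\<close>; those of \<open>b\<close> agree already.\<close>
  have coeff: "scaleS (1 / N) a = a - scaleS (1 / N) (scaleS (N - 1) a)"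
    "scaleS (1 / N ^ 2) (scaleS (N - 1) c) - scaleS (1 / (2 * N ^ 2)) (scaleS 2 c)
      = scaleS (1 / N) (scaleS (1 / N) (scaleS (N - 2) c))"
    "scaleS (1 / N ^ 2) (scaleS (1 / 2) p) + scaleS (1 / (2 * N ^ 2)) p
      = scaleS (1 / N) (scaleS (1 / N) p)"
  proof -
    have "1 / N = 1 - 1 / N * (N - 1)" using N by (simp add: field_simps)
    then show "scaleS (1 / N) a = a - scaleS (1 / N) (scaleS (N - 1) a)"
      by (metis scaleS.scale_left_diff_distrib scaleS.scale_one scaleS.scale_scale)
    have "1 / N ^ 2 * (N - 1) - 1 / (2 * N ^ 2) * 2 = 1 / N * (1 / N * (N - 2))"
      using N by (simp add: field_simps power2_eq_square)
    then show "scaleS (1 / N ^ 2) (scaleS (N - 1) c) - scaleS (1 / (2 * N ^ 2)) (scaleS 2 c)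
      = scaleS (1 / N) (scaleS (1 / N) (scaleS (N - 2) c))"
      by (simp only: scaleS.scale_scale scaleS.scale_left_diff_distrib[symmetric])
    have "1 / N ^ 2 * (1 / 2) + 1 / (2 * N ^ 2) = 1 / N * (1 / N)"
      using N by (simp add: field_simps power2_eq_square)
    then show "scaleS (1 / N ^ 2) (scaleS (1 / 2) p) + scaleS (1 / (2 * N ^ 2)) p
      = scaleS (1 / N) (scaleS (1 / N) p)"
      by (simp only: scaleS.scale_scale scaleS.scale_left_distrib[symmetric])
  qed
  have "dQ (hQ a) + hQ (dQ a) = scaleS (1 / N) a + scaleS (1 / N) b
      + (scaleS (1 / N ^ 2) (scaleS (N - 1) c) - scaleS (1 / (2 * N ^ 2)) (scaleS 2 c))
      - (scaleS (1 / N ^ 2) (scaleS (1 / 2) p) + scaleS (1 / (2 * N ^ 2)) p)"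
    unfolding dh hd scaleS.scale_right_distrib scaleS.scale_right_diff_distrib by (simp only: algebra_simps)
  also have "\<dots> = a - subst_sym (rval (Vj \<mu> R))"
    unfolding coeff \<pi> scaleS.scale_right_distrib scaleS.scale_right_diff_distrib by (simp only: algebra_simps)
  finally have "dQ (hQ a) + hQ (dQ a) = a - subst_sym (rval (Vj \<mu> R))" .
  then show ?thesis by (simp add: lap_def a_def)
qed

lemma lap_genS: "lap (genS j) = genS j - subst_sym (retract (genS j))"
proof (cases j)
  case (Vj \<mu> R)
  then show ?thesis by (simp add: lap_genS_Vj retract_genS del: rval.simps)
next
  case (Uj R)
  \<comment> \<open>For nonempty \<open>R\<close> this count cancels the factor
    1/\<open>size R\<close> in \<open>hval\<close>, and \<open>retract\<close> gives 0. For empty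
    \<open>R\<close> both sides of the claim are 0.\<close>
  have "sum_del (\<lambda>\<rho> S. genS (Uj (add_mset \<rho> S))) R = scaleS (of_nat (size R)) (genS (Uj R) :: onshell)"
    by (rule sum_del_const)
  then show ?thesis
    using Uj by (auto simp add: lap_def genS_brs hQ_genS hQ_simps dQ_simps sum_del_additive[of dQ]
        eta_pairs_linear[of dQ] dQ_Bj sum_del_scaleS retract_genS subst_sym_simps subst_sym_genS field_u_def)
next
  case (Tj R)
  then show ?thesis
    by (simp add: lap_def dQ_genS_Tj hQ_genS hQ_simps dQ_simps hQ_Bj retract_genS subst_sym_simps)
qed

text \<open>The formula of \<open>lap_genS\<close> is linear, so it extends to linear combinations
  of generators such as \<open>F0\<close>, which the composite of \<open>retract\<close> and
  \<open>subst_sym\<close> fixes.\<close>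

lemma lap_F0: "lap (F0 \<mu> \<nu> \<rho>s) = 0"
proof -
  define L where "L x \<longleftrightarrow> lap x = x - subst_sym (retract x)" for x
  have L: "L (genS j)" "L 0" "L x \<Longrightarrow> L y \<Longrightarrow> L (x + y)" "L x \<Longrightarrow> L y \<Longrightarrow> L (x - y)" "L x \<Longrightarrow> L (scaleS c x)"
    for j x y c
    by (simp_all add: L_def lap_genS lap_simps retract_simps subst_sym_simps
        scaleS.scale_right_diff_distrib)
  have L_sum: "L (sum f A)" if "\<And>i. i \<in> A \<Longrightarrow> L (f i)" for f :: "'b \<Rightarrow> onshell" and A
    using that by (induction A rule: infinite_finite_induct) (auto intro: L)
  have "L (F0 \<mu> \<nu> \<rho>s)"
    unfolding F0_def Fstr_eq derivs_B Bj_def by (intro L L_sum)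
  moreover have "subst_sym (retract (F0 \<mu> \<nu> \<rho>s)) = F0 \<mu> \<nu> \<rho>s"
    using subst_sym_retract_subst_sym[of "genS (Fs \<mu> \<nu> \<rho>s)"] by (simp add: subst_sym_genS)
  ultimately show ?thesis by (simp add: L_def)
qed

lemma lap_subst_sym: "lap (subst_sym x) = 0"
proof (induction x rule: salg_induct)
  case (gen g x)
  have "lap (sym_val g) = 0"
    by (cases g) (simp_all add: lap_F0 field_u_def lap_genS retract_genS subst_sym_genS)
  with gen show ?case by (simp add: subst_sym_simps subst_sym_genS lap_mult)
qed (simp_all add: subst_sym_simps subst_sym_one lap_simps lap_one)

text \<open>In the v-part of \<open>F0\<close> the two images are the same derivative of u and
  cancel; the B-corrections are closed by \<open>dQ_Bj\<close>.\<close>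

lemma dQ_subst_sym: "dQ (subst_sym x) = 0"
proof (induction x rule: salg_induct)
  case (gen g x)
  have "dQ (sym_val g) = 0"
  proof (cases g)
    case (Fs \<mu> \<nu> \<rho>s)
    have "dQ (subst_sym (Fm \<mu> \<nu> (mset \<rho>s))) = 0"
      by (simp add: subst_sym_Fm dQ_simps genS_brs eta_del_linear[of dQ] dQ_Bj add_mset_commute)
    with Fs show ?thesis by (simp add: Fm_mset subst_sym_genS)
  qed (simp add: dQ_u)
  with gen show ?case by (simp add: subst_sym_simps subst_sym_genS dQ_mult)
qed (simp_all add: subst_sym_simps subst_sym_one dQ_simps dQ_one)

section \<open>Eigenspaces of the homotopy Laplacian\<close>

text \<open>The bottom layer is \<open>P0\<close> itself rather than the kernel of
  \<open>lap\<close>, so that stripping off the higher eigenvalues ends inside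
  \<open>P0\<close>.\<close>

primrec eig_sum :: "nat \<Rightarrow> onshell set" where
  "eig_sum 0 = P0"
| "eig_sum (Suc n) = {x + y | x y. x \<in> eig_sum n \<and> lap y = scaleS (of_nat (Suc n)) y}"

lemma eig_sum_SucI:
  "x \<in> eig_sum n \<Longrightarrow> lap y = scaleS (of_nat (Suc n)) y \<Longrightarrow> z = x + y \<Longrightarrow> z \<in> eig_sum (Suc n)"
  unfolding eig_sum.simps by blast

lemma eig_sum_SucE:
  assumes "z \<in> eig_sum (Suc n)"
  obtains x y where "z = x + y" "x \<in> eig_sum n" "lap y = scaleS (of_nat (Suc n)) y"
  using assms unfolding eig_sum.simps by blast

lemma subst_sym_in_P0: "subst_sym x \<in> P0"
  by (simp add: P0_def)

lemma P0_cases: "p \<in> P0 \<Longrightarrow> (\<And>x. p = subst_sym x \<Longrightarrow> Q) \<Longrightarrow> Q"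
  by (auto simp: P0_def)

lemma eig_sum_Suc: "x \<in> eig_sum n \<Longrightarrow> x \<in> eig_sum (Suc n)"
  by (rule eig_sum_SucI[of x n 0]) (simp_all add: lap_simps)

lemma eig_sum_mono: "m \<le> n \<Longrightarrow> x \<in> eig_sum m \<Longrightarrow> x \<in> eig_sum n"
  by (induction rule: dec_induct) (auto intro: eig_sum_Suc simp del: eig_sum.simps)

lemma eig_sum_zero: "0 \<in> eig_sum n"
proof -
  have "0 \<in> eig_sum 0" using subst_sym_in_P0[of 0] by (simp add: subst_sym_simps)
  then show ?thesis by (rule eig_sum_mono[OF le0])
qed

lemma eig_sum_add: "x \<in> eig_sum n \<Longrightarrow> y \<in> eig_sum n \<Longrightarrow> x + y \<in> eig_sum n"
proof (induction n arbitrary: x y)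
  case 0
  then show ?case by (auto elim!: P0_cases simp flip: subst_sym_simps(2) intro: subst_sym_in_P0)
next
  case (Suc n)
  obtain x1 x2 where x: "x = x1 + x2" "x1 \<in> eig_sum n" "lap x2 = scaleS (of_nat (Suc n)) x2"
    by (rule eig_sum_SucE[OF Suc.prems(1)])
  obtain y1 y2 where y: "y = y1 + y2" "y1 \<in> eig_sum n" "lap y2 = scaleS (of_nat (Suc n)) y2"
    by (rule eig_sum_SucE[OF Suc.prems(2)])
  show ?case
    by (rule eig_sum_SucI[OF Suc.IH[OF x(2) y(2)], of "x2 + y2"])
      (simp_all add: x(1,3) y(1,3) lap_simps scaleS.scale_right_distrib add_ac del: of_nat_Suc)
qed

text \<open>Common reason for stability under scalars, \<open>lap\<close> and multiplication by
  elements of \<open>P0\<close>: these maps commute with \<open>lap\<close>, hence preserve each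
  eigenspace, and map \<open>P0\<close> to itself.\<close>

lemma eig_sum_map:
  assumes f: "\<And>x y. f (x + y) = f x + f y" "\<And>c x. f (scaleS c x) = scaleS c (f x)"
    "\<And>x. f (lap x) = lap (f x)" and P0: "\<And>x. f (subst_sym x) \<in> P0"
  shows "x \<in> eig_sum n \<Longrightarrow> f x \<in> eig_sum n"
proof (induction n arbitrary: x)
  case 0
  then show ?case by (auto elim!: P0_cases intro: P0)
next
  case (Suc n)
  obtain x1 x2 where x: "x = x1 + x2" "x1 \<in> eig_sum n" "lap x2 = scaleS (of_nat (Suc n)) x2"
    by (rule eig_sum_SucE[OF Suc.prems(1)])
  have "lap (f x2) = scaleS (of_nat (Suc n)) (f x2)"
    unfolding f(3)[symmetric] x(3) by (rule f(2))
  then show ?case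
    by (rule eig_sum_SucI[OF Suc.IH[OF x(2)]]) (simp add: x(1) f(1))
qed

lemma eig_sum_scaleS: "x \<in> eig_sum n \<Longrightarrow> scaleS c x \<in> eig_sum n"
  by (rule eig_sum_map[where f = "scaleS c"])
    (simp_all add: scaleS.scale_right_distrib mult.commute lap_simps subst_sym_in_P0 flip: subst_sym_simps(4))

lemma eig_sum_lap: "x \<in> eig_sum n \<Longrightarrow> lap x \<in> eig_sum n"
  by (rule eig_sum_map[where f = lap])
    (use eig_sum_zero[of 0] in \<open>simp_all add: lap_simps lap_subst_sym\<close>)

lemma eig_sum_subst_sym_mult: "x \<in> eig_sum n \<Longrightarrow> subst_sym z * x \<in> eig_sum n"
  by (rule eig_sum_map[where f = "\<lambda>x. subst_sym z * x"])
    (simp_all add: distrib_left scaleS_mult_right lap_mult lap_subst_sym subst_sym_in_P0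
      flip: subst_sym_simps(5))

text \<open>As \<open>lap\<close> is a derivation, eigenvalues add under multiplication; multiplying
  by \<open>e\<close> raises each of them by 1.\<close>

lemma eig_sum_eigen_mult:
  assumes e: "lap e = e"
  shows "x \<in> eig_sum n \<Longrightarrow> e * x \<in> eig_sum (Suc n)"
proof (induction n arbitrary: x)
  case 0
  then show ?case
    by (intro eig_sum_SucI[OF eig_sum_zero, of "e * x"])
      (auto elim!: P0_cases simp: lap_mult lap_subst_sym e)
next
  case (Suc n)
  obtain x1 x2 where x: "x = x1 + x2" "x1 \<in> eig_sum n" "lap x2 = scaleS (of_nat (Suc n)) x2"
    by (rule eig_sum_SucE[OF Suc.prems(1)])
  have "lap (e * x2) = scaleS (1 + of_nat (Suc n)) (e * x2)"
    by (simp add: lap_mult e x(3) scaleS_mult_right scaleS.scale_left_distrib del: of_nat_Suc)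
  then have "lap (e * x2) = scaleS (of_nat (Suc (Suc n))) (e * x2)" by simp
  then show ?case
    by (rule eig_sum_SucI[OF Suc.IH[OF x(2)]]) (simp add: x(1) distrib_left)
qed

lemma eig_sum_exhaust: "\<exists>n. x \<in> eig_sum n"
proof (induction x rule: salg_induct)
  case zero
  show ?case using eig_sum_zero by blast
next
  case (one c)
  have "scaleS c 1 = subst_sym (scaleS c 1)" by (simp add: subst_sym_simps subst_sym_one)
  then have "scaleS c 1 \<in> eig_sum 0" by (metis eig_sum.simps(1) subst_sym_in_P0)
  then show ?case by blast
next
  case (gen g x)
  then obtain n where n: "x \<in> eig_sum n" by blast
  \<comment> \<open>Splits the generator into \<open>z\<close> in \<open>P0\<close> and the
    remainder \<open>genS g - z\<close>, an eigenvector of eigenvalue 1.\<close>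
  define z where "z = subst_sym (retract (genS g))"
  have "lap (genS g - z) = genS g - z"
    by (simp add: z_def lap_simps lap_genS lap_subst_sym)
  then have "(genS g - z) * x \<in> eig_sum (Suc n)" using n by (rule eig_sum_eigen_mult)
  moreover have "z * x \<in> eig_sum (Suc n)"
    unfolding z_def by (rule eig_sum_subst_sym_mult) (rule eig_sum_Suc, rule n)
  ultimately have "(genS g - z) * x + z * x \<in> eig_sum (Suc n)" by (rule eig_sum_add)
  moreover have "(genS g - z) * x + z * x = genS g * x" by (simp add: algebra_simps)
  ultimately show ?case by metis
next
  case (add x y)
  then obtain m n where "x \<in> eig_sum m" "y \<in> eig_sum n" by blast
  then have "x + y \<in> eig_sum (max m n)"
    by (intro eig_sum_add) (auto elim: eig_sum_mono[rotated])
  then show ?case by blast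
qed

section \<open>Reduction of cocycles and the isomorphism\<close>

lemma cohomologous_P0:
  assumes "x \<in> eig_sum n" "dQ x = 0"
  shows "\<exists>q\<in>P0. cohomologous x q"
  using assms
proof (induction n arbitrary: x)
  case 0
  then have "x \<in> P0" by simp
  with cohomologous_eqI[OF "0.prems"(2) refl] show ?case by blast
next
  case (Suc n)
  define N :: complex where "N = of_nat (Suc n)"
  have N: "N \<noteq> 0" unfolding N_def by (simp only: of_nat_eq_0_iff)
  obtain x1 x2 where x: "x = x1 + x2" "x1 \<in> eig_sum n" "lap x2 = scaleS N x2"
    unfolding N_def by (rule eig_sum_SucE[OF Suc.prems(1)])
  \<comment> \<open>A change by a coboundary which, since \<open>dQ x = 0\<close>, acts as 1 -
    \<open>lap\<close>/N. It annihilates \<open>x2\<close> and keeps \<open>x1\<close> in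
    \<open>eig_sum n\<close>.\<close>
  define z where "z = x - dQ (scaleS (1 / N) (hQ x))"
  have "z = x - scaleS (1 / N) (lap x)"
    using Suc.prems(2) by (simp add: z_def lap_def dQ_simps hQ_simps)
  also have "\<dots> = x1 + scaleS (- 1 / N) (lap x1)"
    using N by (simp add: x lap_simps scaleS.scale_right_distrib)
  finally have "z \<in> eig_sum n"
    using x(2) by (simp add: eig_sum_add eig_sum_scaleS eig_sum_lap del: scaleS.scale_minus_left)
  moreover have dz: "dQ z = 0" using Suc.prems(2) by (simp add: z_def dQ_simps dQ_dQ)
  ultimately obtain q where q: "q \<in> P0" "cohomologous z q" using Suc.IH by blast
  have "cohomologous x z"
    using Suc.prems(2) dz unfolding cohomologous_iff z_def by (auto simp: algebra_simps)
  then have "cohomologous x q" using q(2) cohomologous_add[of x z z q] by (simp add: cohomologous_def)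
  with q(1) show ?case by blast
qed

text \<open>Yields well-definedness and injectivity of \<open>sym_coh\<close> at once. From left to
  right, \<open>retract\<close> kills the coboundary and returns \<open>x - y\<close> up to the
  Bianchi ideal.\<close>

lemma cohomologous_subst_sym_iff: "cohomologous (subst_sym x) (subst_sym y) \<longleftrightarrow> x - y \<in> bianchi_ideal"
proof
  assume "cohomologous (subst_sym x) (subst_sym y)"
  then obtain r where "subst_sym (x - y) = dQ r"
    by (auto simp: cohomologous_iff subst_sym_simps)
  then have "retract (subst_sym (x - y)) = 0" by (simp add: retract_dQ)
  then have "- (x - y) \<in> bianchi_ideal" using retract_subst_sym[of "x - y"] by simp
  then show "x - y \<in> bianchi_ideal"
    unfolding bianchi_ideal_def using ideal_gen_uminus by fastforce
next
  assume "x - y \<in> bianchi_ideal"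
  then have "subst_sym x = subst_sym y"
    using subst_sym_bianchi_ideal by (force simp: subst_sym_simps)
  then show "cohomologous (subst_sym x) (subst_sym y)"
    by (intro cohomologous_eqI dQ_subst_sym)
qed

lift_definition sym_coh :: "P0_bianchi \<Rightarrow> H_Q" is subst_sym
  by (simp add: cohomologous_subst_sym_iff)

lemma linear_sym_coh: "Vector_Spaces.linear bianchi_scale H_scale sym_coh"
proof (intro Vector_Spaces.linear_iff[THEN iffD2] conjI allI vector_space_bianchi_scale vector_space_H_scale)
  show "sym_coh (x + y) = sym_coh x + sym_coh y" for x y
    by transfer (rule cohomologous_eqI[OF dQ_subst_sym], simp add: subst_sym_simps)
  show "sym_coh (bianchi_scale c x) = H_scale c (sym_coh x)" for c x
    by transfer (rule cohomologous_eqI[OF dQ_subst_sym], simp add: subst_sym_simps)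
qed

lemma bij_sym_coh: "bij sym_coh"
proof (rule bijI)
  show "inj sym_coh"
  proof (rule injI)
    show "sym_coh x = sym_coh y \<Longrightarrow> x = y" for x y
      by transfer (simp add: cohomologous_subst_sym_iff)
  qed
  show "surj sym_coh"
    unfolding surj_def
  proof
    show "\<exists>x. y = sym_coh x" for y
    proof transfer
      fix p assume "cohomologous p p"
      then have "dQ p = 0" by (simp add: cohomologous_iff)
      with eig_sum_exhaust[of p] cohomologous_P0 show "\<exists>x. cohomologous p (subst_sym x)"
        by (force simp: P0_def)
    qed
  qed
qed

theorem theorem5p3:
  shows "(\<forall>p\<in>Z_Q. \<exists>q\<in>P0. cohomologous p q)
    \<and> P0 \<subseteq> Z_Q
    \<and> (\<exists>\<Phi>. Vector_Spaces.linear bianchi_scale H_scale \<Phi> \<and> bij \<Phi>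
          \<and> (\<forall>x. \<Phi> (bianchi_class x) = coh_class (subst_sym x)))"
proof (intro conjI)
  show "\<forall>p\<in>Z_Q. \<exists>q\<in>P0. cohomologous p q"
    using eig_sum_exhaust cohomologous_P0 unfolding Z_Q_def by blast
  show "P0 \<subseteq> Z_Q"
    by (auto simp: P0_def Z_Q_def dQ_subst_sym)
  show "\<exists>\<Phi>. Vector_Spaces.linear bianchi_scale H_scale \<Phi> \<and> bij \<Phi>
      \<and> (\<forall>x. \<Phi> (bianchi_class x) = coh_class (subst_sym x))"
    using linear_sym_coh bij_sym_coh
    by (intro exI[of _ sym_coh]) (simp add: bianchi_class_def coh_class_def sym_coh.abs_eq)
qed

end
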